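(* Let $K\subseteq k((G))$ be a Hahn field with the first lifting property and the canonical second lifting property. Then \begin{align*} v\text{-}\mathrm{Aut}^{+}K &= (1\text{-}\mathrm{Aut}^{+}K\rtimes G\text{-}\mathrm{Exp}\,K)\rtimes \mathrm{ExtAut}\,K\\ &\simeq (1\text{-}\mathrm{Aut}^{+}K\rtimes \mathrm{Hom}(G,k^\times))\rtimes(\mathrm{Aut}\,k\times o\text{-}\mathrm{Aut}\,G);\\ v\text{-}\mathrm{Aut}_{(k)}^{+}K &= (1\text{-}\mathrm{Aut}_k^{+}K\rtimes G\text{-}\mathrm{Exp}\,K)\rtimes \mathrm{ExtAut}\,K\\ &\simeq (1\text{-}\mathrm{Aut}_k^{+}K\rtimes \mathrm{Hom}(G,k^\times))\rtimes(\mathrm{Aut}\,k\times o\text{-}\mathrm{Aut}\,G);\\ v\text{-}\mathrm{Aut}_{k}^{+}K &= (1\text{-}\mathrm{Aut}_k^{+}K\rtimes G\text{-}\mathrm{Exp}\,K)\rtimes \mathrm{ExtAut}_k\,K\\ &\simeq (1\text{-}\mathrm{Aut}_k^{+}K\rtimes \mathrm{Hom}(G,k^\times))\rtimes o\text{-}\mathrm{Aut}\,G. \end{align*}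
   Context: Let $k$ be a field and $(G,+,<)$ a totally ordered abelian group. $\mathbb K=k((G))$ is the field of all formal series $a=\sum_{g\in G}a_gt^g$ ($a_g\in k$) whose support $\operatorname{supp}a=\{g:a_g\neq 0\}$ is well ordered, with termwise addition and convolution product. $k(G)\subseteq\mathbb K$ is the fraction field of the group ring $k[G]$ (series with finite support). A Hahn field is a field $K$ with $k(G)\subseteq K\subseteq \mathbb K$. It carries the valuation $v(a)=\min\operatorname{supp}a$ for $a\neq0$, $v(0)=\infty$, with value group $G$. $\mathrm{Aut}\,k$ is the group of field automorphisms of $k$; $o\text{-}\mathrm{Aut}\,G$ is the group of order preserving automorphisms of $G$. $v\text{-}\mathrm{Aut}\,K$ is the group of valuation preserving automorphisms: field automorphisms $\sigma$ of $K$ for which there is $\tau\in o\text{-}\mathrm{Aut}\,G$ with $\tau(v(a))=v(\sigma(a))$ for all $a\in K^\times$. For any group of automorphisms of $K$, the subscript $(k)$ denotes the subgroup of those $\sigma$ with $\sigma(k)=k$, the subscript $k$ the subgroup of those with $\sigma|_k=\mathrm{id}_k$. For $\sigma\in v\text{-}\mathrm{Aut}\,K$ let $\sigma_G\in o\text{-}\mathrm{Aut}\,G$, $\sigma_G(v(a))=v(\sigma(a))$, and $\sigma_k\in\mathrm{Aut}\,k$, $\sigma_k(c)=\sigma(c)_0$ (constant term) for $c\in k$. This gives a group homomorphism $\Phi\colon v\text{-}\mathrm{Aut}\,K\to\mathrm{Aut}\,k\times o\text{-}\mathrm{Aut}\,G$, $\sigma\mapsto(\sigma_k,\sigma_G)$.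 Put $\mathrm{IntAut}\,K:=\ker\Phi$. $K$ has the first lifting property if there is an injective group homomorphism $\Psi\colon \mathrm{Aut}\,k\times o\text{-}\mathrm{Aut}\,G\to v\text{-}\mathrm{Aut}\,K$ with $\Phi\Psi=\mathrm{id}$; such a $\Psi$ is fixed and $\mathrm{ExtAut}\,K:=\operatorname{im}\Psi$. Convention: if the maps $\sum a_gt^g\mapsto\sum\rho(a_g)t^{\tau(g)}$ send $K$ onto $K$ for all $(\rho,\tau)$, then $\Psi$ is chosen to assign to $(\rho,\tau)$ this map restricted to $K$. $\mathrm{Hom}(G,k^\times)$ is the group, under pointwise multiplication, of homomorphisms $x\colon(G,+)\to(k^\times,\cdot)$, $x^g:=x(g)$. $K$ has the canonical second lifting property if $x\mapsto\rho_x$, $\rho_x(\sum a_gt^g)=\sum a_gx^gt^g$, is a well defined group homomorphism $\mathrm{Hom}(G,k^\times)\to\mathrm{IntAut}\,K$; its image is the group $G\text{-}\mathrm{Exp}\,K$ of $G$-exponentiations. The group of 1-automorphisms is $1\text{-}\mathrm{Aut}\,K:=\{\sigma\in\mathrm{IntAut}\,K:\sigma(t^g)_g=1\text{ for all }g\in G\}$. A family $\{a_{(i)}\}_{i\in I}\subseteq\mathbb K$ is summable if $\bigcup_i\operatorname{supp}a_{(i)}$ is well ordered and each $g$ lies in $\operatorname{supp}a_{(i)}$ for only finitely many $i$; its sum is then $\sum_ia_{(i)}:=\sum_g\big(\sum_i(a_{(i)})_g\big)t^g\in\mathbb K$. It is $K$-summable if it is a summable family of elements of $K$ whose sum lies in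 $K$. A map $\sigma\colon K\to K$ is $K$-summable if for every $a=\sum a_gt^g\in K$ the family $\{\sigma(a_gt^g):g\in\operatorname{supp}a\}$ is $K$-summable with sum $\sigma(a)$. $\sigma\in v\text{-}\mathrm{Aut}\,K$ is strongly additive if both $\sigma$ and $\sigma^{-1}$ are $K$-summable. The superscript $+$ on a group of automorphisms denotes its subset of strongly additive elements. Semi-direct products are written with the normal factor on the left. The equalities are inner semi-direct products; in the isomorphisms the actions are induced by conjugation via the identifications $x\mapsto\rho_x$ and $\mathrm{ExtAut}\,K\simeq\mathrm{Aut}\,k\times o\text{-}\mathrm{Aut}\,G$ (respectively $\mathrm{ExtAut}_kK\simeq o\text{-}\mathrm{Aut}\,G$).
   Formalization: It is additionally assumed that v-Aut⁺K is a group (closed under composition and inverses), and, when the canonical lifts do not all map K onto K, that ExtAut K ⊆ v-Aut⁺_(k)K; the claim fails without these, and both follow from its conclusion. *)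

theory Defs
  imports "HOL-Algebra.Bij" "HOL-Algebra.Subrings" "HOL-Algebra.QuotRing"
begin

section \<open>The field of formal series\<close>

text \<open>A series is its coefficient function. The coefficient field and the value group are the
  types \<open>'k\<close> and \<open>'g\<close>; rings and groups of maps are structures of \<open>HOL-Algebra\<close>.\<close>

definition supp :: "('g \<Rightarrow> 'k::zero) \<Rightarrow> 'g set" where
  "supp a = {g. a g \<noteq> 0}"

definition well_ordered :: "'g::linorder set \<Rightarrow> bool" where
  "well_ordered S \<longleftrightarrow> (\<forall>T. T \<subseteq> S \<and> T \<noteq> {} \<longrightarrow> (\<exists>m\<in>T. \<forall>x\<in>T. m \<le> x))"

definition mon :: "'k::zero \<Rightarrow> 'g \<Rightarrow> 'g \<Rightarrow> 'k" where
  "mon c g = (\<lambda>h. if h = g then c else 0)"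

text \<open>The index set in the convolution is finite when both supports are well ordered.\<close>

definition conv ::
  "('g::ab_group_add \<Rightarrow> 'k::semiring_0) \<Rightarrow> ('g \<Rightarrow> 'k) \<Rightarrow> 'g \<Rightarrow> 'k" where
  "conv a b = (\<lambda>g. \<Sum>h | h \<in> supp a \<and> g - h \<in> supp b. a h * b (g - h))"

definition hahn :: "('g::linordered_ab_group_add \<Rightarrow> 'k::field) ring" where
  "hahn = \<lparr>carrier = {a. well_ordered (supp a)}, mult = conv, one = mon 1 0,
           zero = (\<lambda>g. 0), add = (\<lambda>a b g. a g + b g)\<rparr>"

definition group_ring :: "('g::linordered_ab_group_add \<Rightarrow> 'k::field) set" where
  "group_ring = {p. finite (supp p)}"

definition group_ring_fractions :: "('g::linordered_ab_group_add \<Rightarrow> 'k::field) set" where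
  "group_ring_fractions =
     {p \<otimes>\<^bsub>hahn\<^esub> inv\<^bsub>hahn\<^esub> q | p q. p \<in> group_ring \<and> q \<in> group_ring \<and> q \<noteq> \<zero>\<^bsub>hahn\<^esub>}"

definition hahn_field :: "('g::linordered_ab_group_add \<Rightarrow> 'k::field) set \<Rightarrow> bool" where
  "hahn_field K \<longleftrightarrow> subfield K hahn \<and> group_ring_fractions \<subseteq> K"

text \<open>The valuation; the value at \<open>0\<close> (which would be infinity) is never used.\<close>

definition val :: "('g::linorder \<Rightarrow> 'k::zero) \<Rightarrow> 'g" where
  "val a = (LEAST g. g \<in> supp a)"


section \<open>Automorphisms\<close>

definition AutCoeff :: "('k::field \<Rightarrow> 'k) monoid" where
  "AutCoeff = BijGroup UNIV
     \<lparr>carrier := {\<rho>. bij \<rho> \<and> (\<forall>c d. \<rho> (c + d) = \<rho> c + \<rho> d) \<and>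
                      (\<forall>c d. \<rho> (c * d) = \<rho> c * \<rho> d) \<and> \<rho> 1 = 1}\<rparr>"

definition oAut :: "('g::linordered_ab_group_add \<Rightarrow> 'g) monoid" where
  "oAut = BijGroup UNIV
     \<lparr>carrier := {\<tau>. bij \<tau> \<and> (\<forall>g h. \<tau> (g + h) = \<tau> g + \<tau> h) \<and> strict_mono \<tau>}\<rparr>"

text \<open>All automorphisms of \<open>K\<close> are elements of \<^term>\<open>BijGroup K\<close>, that is, bijections of \<open>K\<close> which
  are \<^term>\<open>undefined\<close> outside \<open>K\<close>. Sets of automorphisms are given as sets of maps and become
  groups as \<^term>\<open>BijGroup K\<lparr>carrier := A\<rparr>\<close>.\<close>

definition vAut :: "('g::linordered_ab_group_add \<Rightarrow> 'k::field) set \<Rightarrow> (('g \<Rightarrow> 'k) \<Rightarrow> 'g \<Rightarrow> 'k) set" where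
  "vAut K = {\<sigma> \<in> ring_iso (hahn\<lparr>carrier := K\<rparr>) (hahn\<lparr>carrier := K\<rparr>) \<inter> extensional K.
      \<exists>\<tau>\<in>carrier oAut. \<forall>a\<in>K - {\<zero>\<^bsub>hahn\<^esub>}. \<tau> (val a) = val (\<sigma> a)}"

definition value_part ::
  "('g::linordered_ab_group_add \<Rightarrow> 'k::field) set \<Rightarrow> (('g \<Rightarrow> 'k) \<Rightarrow> 'g \<Rightarrow> 'k) \<Rightarrow> 'g \<Rightarrow> 'g" where
  "value_part K \<sigma> =
     (THE \<tau>. \<tau> \<in> carrier oAut \<and> (\<forall>a\<in>K - {\<zero>\<^bsub>hahn\<^esub>}. \<tau> (val a) = val (\<sigma> a)))"

definition coeff_part :: "(('g::zero \<Rightarrow> 'k::zero) \<Rightarrow> 'g \<Rightarrow> 'k) \<Rightarrow> 'k \<Rightarrow> 'k" where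
  "coeff_part \<sigma> = (\<lambda>c. \<sigma> (mon c 0) 0)"

definition Phi ::
  "('g::linordered_ab_group_add \<Rightarrow> 'k::field) set \<Rightarrow> (('g \<Rightarrow> 'k) \<Rightarrow> 'g \<Rightarrow> 'k)
     \<Rightarrow> ('k \<Rightarrow> 'k) \<times> ('g \<Rightarrow> 'g)" where
  "Phi K \<sigma> = (coeff_part \<sigma>, value_part K \<sigma>)"

definition IntAut :: "('g::linordered_ab_group_add \<Rightarrow> 'k::field) set \<Rightarrow> (('g \<Rightarrow> 'k) \<Rightarrow> 'g \<Rightarrow> 'k) set" where
  "IntAut K = kernel (BijGroup K\<lparr>carrier := vAut K\<rparr>) (AutCoeff \<times>\<times> oAut) (Phi K)"

definition oneAut :: "('g::linordered_ab_group_add \<Rightarrow> 'k::field) set \<Rightarrow> (('g \<Rightarrow> 'k) \<Rightarrow> 'g \<Rightarrow> 'k) set" where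
  "oneAut K = {\<sigma> \<in> IntAut K. \<forall>g. \<sigma> (mon 1 g) g = 1}"

text \<open>The subscripts \<open>(k)\<close> and \<open>k\<close>.\<close>

definition stab_coeff :: "(('g::zero \<Rightarrow> 'k::zero) \<Rightarrow> 'g \<Rightarrow> 'k) set \<Rightarrow> (('g \<Rightarrow> 'k) \<Rightarrow> 'g \<Rightarrow> 'k) set" where
  "stab_coeff A = {\<sigma> \<in> A. \<sigma> ` range (\<lambda>c. mon c 0) = range (\<lambda>c. mon c 0)}"

definition fix_coeff :: "(('g::zero \<Rightarrow> 'k::zero) \<Rightarrow> 'g \<Rightarrow> 'k) set \<Rightarrow> (('g \<Rightarrow> 'k) \<Rightarrow> 'g \<Rightarrow> 'k) set" where
  "fix_coeff A = {\<sigma> \<in> A. \<forall>c. \<sigma> (mon c 0) = mon c 0}"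


section \<open>Lifting properties\<close>

definition canonical_lift ::
  "('g::linordered_ab_group_add \<Rightarrow> 'k::field) set \<Rightarrow> ('k \<Rightarrow> 'k) \<times> ('g \<Rightarrow> 'g)
     \<Rightarrow> ('g \<Rightarrow> 'k) \<Rightarrow> 'g \<Rightarrow> 'k" where
  "canonical_lift K = (\<lambda>(\<rho>, \<tau>). \<lambda>a\<in>K. \<lambda>h. \<rho> (a (inv_into UNIV \<tau> h)))"

definition canonical_first_lifting :: "('g::linordered_ab_group_add \<Rightarrow> 'k::field) set \<Rightarrow> bool" where
  "canonical_first_lifting K \<longleftrightarrow> (\<forall>p\<in>carrier (AutCoeff \<times>\<times> oAut). canonical_lift K p ` K = K)"

text \<open>\<open>\<Psi>\<close> witnesses the first lifting property of \<open>K\<close>, and is the canonical choice if the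
  canonical lifts are available. Otherwise \<open>\<Psi>\<close> is an arbitrary section, and its values need not be
  strongly additive.\<close>

definition first_lifting ::
  "('g::linordered_ab_group_add \<Rightarrow> 'k::field) set
     \<Rightarrow> (('k \<Rightarrow> 'k) \<times> ('g \<Rightarrow> 'g) \<Rightarrow> ('g \<Rightarrow> 'k) \<Rightarrow> 'g \<Rightarrow> 'k) \<Rightarrow> bool" where
  "first_lifting K \<Psi> \<longleftrightarrow>
     \<Psi> \<in> hom (AutCoeff \<times>\<times> oAut) (BijGroup K\<lparr>carrier := vAut K\<rparr>) \<and>
     inj_on \<Psi> (carrier (AutCoeff \<times>\<times> oAut)) \<and>
     (\<forall>p\<in>carrier (AutCoeff \<times>\<times> oAut). Phi K (\<Psi> p) = p) \<and>
     (canonical_first_lifting K \<longrightarrow> (\<forall>p\<in>carrier (AutCoeff \<times>\<times> oAut). \<Psi> p = canonical_lift K p))"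

definition ExtAut ::
  "(('k::field \<Rightarrow> 'k) \<times> ('g::linordered_ab_group_add \<Rightarrow> 'g) \<Rightarrow> ('g \<Rightarrow> 'k) \<Rightarrow> 'g \<Rightarrow> 'k)
     \<Rightarrow> (('g \<Rightarrow> 'k) \<Rightarrow> 'g \<Rightarrow> 'k) set" where
  "ExtAut \<Psi> = \<Psi> ` carrier (AutCoeff \<times>\<times> oAut)"

definition HomGroup :: "('g::ab_group_add \<Rightarrow> 'k::field) monoid" where
  "HomGroup = \<lparr>carrier = {x. (\<forall>g. x g \<noteq> 0) \<and> (\<forall>g h. x (g + h) = x g * x h)},
               mult = (\<lambda>x y g. x g * y g), one = (\<lambda>g. 1)\<rparr>"

definition g_exp :: "('g \<Rightarrow> 'k::field) set \<Rightarrow> ('g \<Rightarrow> 'k) \<Rightarrow> ('g \<Rightarrow> 'k) \<Rightarrow> 'g \<Rightarrow> 'k" where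
  "g_exp K x = (\<lambda>a\<in>K. \<lambda>g. a g * x g)"

definition canonical_second_lifting :: "('g::linordered_ab_group_add \<Rightarrow> 'k::field) set \<Rightarrow> bool" where
  "canonical_second_lifting K \<longleftrightarrow> g_exp K \<in> hom HomGroup (BijGroup K\<lparr>carrier := IntAut K\<rparr>)"

definition GExp :: "('g::linordered_ab_group_add \<Rightarrow> 'k::field) set \<Rightarrow> (('g \<Rightarrow> 'k) \<Rightarrow> 'g \<Rightarrow> 'k) set" where
  "GExp K = g_exp K ` carrier HomGroup"


section \<open>Strong additivity\<close>

definition summable_family :: "'i set \<Rightarrow> ('i \<Rightarrow> 'g::linorder \<Rightarrow> 'k::zero) \<Rightarrow> bool" where
  "summable_family I a \<longleftrightarrow>
     well_ordered (\<Union>i\<in>I. supp (a i)) \<and> (\<forall>g. finite {i \<in> I. g \<in> supp (a i)})"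

definition family_sum :: "'i set \<Rightarrow> ('i \<Rightarrow> 'g \<Rightarrow> 'k::comm_monoid_add) \<Rightarrow> 'g \<Rightarrow> 'k" where
  "family_sum I a = (\<lambda>g. \<Sum>i | i \<in> I \<and> g \<in> supp (a i). a i g)"

definition K_summable_family ::
  "('g::linorder \<Rightarrow> 'k::comm_monoid_add) set \<Rightarrow> 'i set \<Rightarrow> ('i \<Rightarrow> 'g \<Rightarrow> 'k) \<Rightarrow> bool" where
  "K_summable_family K I a \<longleftrightarrow> summable_family I a \<and> a ` I \<subseteq> K \<and> family_sum I a \<in> K"

definition K_summable_map ::
  "('g::linorder \<Rightarrow> 'k::comm_monoid_add) set \<Rightarrow> (('g \<Rightarrow> 'k) \<Rightarrow> 'g \<Rightarrow> 'k) \<Rightarrow> bool" where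
  "K_summable_map K \<sigma> \<longleftrightarrow>
     (\<forall>a\<in>K. K_summable_family K (supp a) (\<lambda>g. \<sigma> (mon (a g) g)) \<and>
             family_sum (supp a) (\<lambda>g. \<sigma> (mon (a g) g)) = \<sigma> a)"

text \<open>The superscript \<open>+\<close>: the subset of strongly additive elements. Since summability of a map only
  concerns the monomials of each single series in \<open>K\<close>, a composition of strongly additive maps
  need not be strongly additive. Example: let the coefficient field have two elements, let \<open>G\<close> be
  the subgroup of the reals generated by algebraically independent numbers \<open>g_n\<close> in \<open>(0,1)\<close>,
  \<open>h_n\<close> in \<open>(2,3)\<close>, \<open>p_n\<close> in \<open>(4,5)\<close>, where \<open>g_n\<close> and \<open>h_n\<close> increase and \<open>p_n\<close> decreases. Write
  \<open>X_n\<close>, \<open>Y_n\<close>, \<open>P_n\<close> for the monomials with these exponents and let \<open>K = k(G)(a)\<close>, where \<open>a\<close> is the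
  sum of all \<open>X_n\<close>. Let \<open>\<tau>\<close> map \<open>X_n\<close> to \<open>X_n + Y_n + Y_{n+1}\<close> and \<open>a\<close> to \<open>a + Y_0\<close>, let \<open>\<sigma>\<close> map \<open>Y_n\<close> to
  \<open>Y_n + P_n\<close>, the other generators being fixed. Both are strongly additive, but all \<open>p_n\<close> occur in
  the supports of the \<open>\<sigma> (\<tau> X_n)\<close>.\<close>

definition strong ::
  "('g::linorder \<Rightarrow> 'k::comm_monoid_add) set \<Rightarrow> (('g \<Rightarrow> 'k) \<Rightarrow> 'g \<Rightarrow> 'k) set
     \<Rightarrow> (('g \<Rightarrow> 'k) \<Rightarrow> 'g \<Rightarrow> 'k) set" where
  "strong K A = {\<sigma> \<in> A. K_summable_map K \<sigma> \<and> K_summable_map K (inv\<^bsub>BijGroup K\<^esub> \<sigma>)}"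


section \<open>Semidirect products\<close>

definition inner_semidirect :: "('a, 'm) monoid_scheme \<Rightarrow> 'a set \<Rightarrow> 'a set \<Rightarrow> bool" where
  "inner_semidirect G N H \<longleftrightarrow>
     group G \<and> N \<lhd> G \<and> subgroup H G \<and> N \<inter> H = {\<one>\<^bsub>G\<^esub>} \<and> N <#>\<^bsub>G\<^esub> H = carrier G"

text \<open>\<open>A = (N \<rtimes> E) \<rtimes> X\<close> for subsets of an ambient group \<open>U\<close>.\<close>

definition inner_semidirect3 ::
  "('a, 'm) monoid_scheme \<Rightarrow> 'a set \<Rightarrow> 'a set \<Rightarrow> 'a set \<Rightarrow> 'a set \<Rightarrow> bool" where
  "inner_semidirect3 U A N E X \<longleftrightarrow>
     inner_semidirect (U\<lparr>carrier := N <#>\<^bsub>U\<^esub> E\<rparr>) N E \<and>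
     inner_semidirect (U\<lparr>carrier := A\<rparr>) (N <#>\<^bsub>U\<^esub> E) X"

definition semidirect ::
  "('a, 'm) monoid_scheme \<Rightarrow> ('b, 'n) monoid_scheme \<Rightarrow> ('b \<Rightarrow> 'a \<Rightarrow> 'a) \<Rightarrow> ('a \<times> 'b) monoid" where
  "semidirect N H \<alpha> =
     \<lparr>carrier = carrier N \<times> carrier H,
      mult = (\<lambda>(n, h) (n', h'). (n \<otimes>\<^bsub>N\<^esub> \<alpha> h n', h \<otimes>\<^bsub>H\<^esub> h')),
      one = (\<one>\<^bsub>N\<^esub>, \<one>\<^bsub>H\<^esub>)\<rparr>"

text \<open>Conjugation in \<open>U\<close>, transported along identifications \<open>i\<close> of \<open>N\<close> and \<open>j\<close> of the acting
  group with subgroups of \<open>U\<close>.\<close>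

definition conj_action ::
  "('u, 'm) monoid_scheme \<Rightarrow> ('a, 'n) monoid_scheme \<Rightarrow> ('a \<Rightarrow> 'u) \<Rightarrow> ('b \<Rightarrow> 'u) \<Rightarrow> 'b \<Rightarrow> 'a \<Rightarrow> 'a" where
  "conj_action U N i j =
     (\<lambda>h. \<lambda>n\<in>carrier N. inv_into (carrier N) i (j h \<otimes>\<^bsub>U\<^esub> i n \<otimes>\<^bsub>U\<^esub> inv\<^bsub>U\<^esub> (j h)))"

text \<open>\<open>A \<simeq> (N \<rtimes> E) \<rtimes> H\<close> for subsets \<open>A\<close>, \<open>N\<close> of \<open>U\<close> and groups \<open>E\<close>, \<open>H\<close> identified with subgroups
  of \<open>U\<close> by \<open>e\<close>, \<open>j\<close>, both actions being induced by conjugation in \<open>U\<close>.\<close>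

definition outer_semidirect3 ::
  "('u, 'm) monoid_scheme \<Rightarrow> 'u set \<Rightarrow> 'u set \<Rightarrow> ('a, 'n) monoid_scheme \<Rightarrow> ('a \<Rightarrow> 'u)
     \<Rightarrow> ('b, 'l) monoid_scheme \<Rightarrow> ('b \<Rightarrow> 'u) \<Rightarrow> bool" where
  "outer_semidirect3 U A N E e H j \<longleftrightarrow>
     (let M = U\<lparr>carrier := N\<rparr>;
          \<alpha> = conj_action U M (\<lambda>n. n) e;
          P = semidirect M E \<alpha>;
          \<beta> = conj_action U P (\<lambda>(n, x). n \<otimes>\<^bsub>U\<^esub> e x) j
      in \<alpha> \<in> hom E (AutoGroup M) \<and> \<beta> \<in> hom H (AutoGroup P) \<and>
         U\<lparr>carrier := A\<rparr> \<cong> semidirect P H \<beta>)"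

end

theory Submission
  imports Defs
begin

text \<open>
  Valuation preserving automorphisms of a field \<open>K\<close> of formal series are controlled on leading
  terms. If \<open>\<sigma>\<close> induces \<open>\<sigma>\<^sub>k\<close> on the coefficients and \<open>\<tau> = \<sigma>\<^sub>G\<close> on the values, and if
  \<open>a\<close> vanishes below \<open>g\<close>, then the coefficient of \<open>\<sigma>(a)\<close> at \<open>\<tau>(g)\<close> is
  \<open>\<sigma>\<^sub>k(a\<^sub>g)\<close> times the coefficient of \<open>\<sigma>(t\<^sup>g)\<close> at \<open>\<tau>(g)\<close> (\<open>vAut_lead\<close>). Two
  homomorphisms result from this formula. One is \<open>\<Phi>\<close>, onto pairs of automorphisms of \<open>k\<close> and of
  \<open>G\<close>, with the internal automorphisms as kernel (\<open>Phi_hom\<close>). The other maps an internal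
  automorphism \<open>\<sigma>\<close> to the character \<open>g \<mapsto> \<sigma>(t\<^sup>g)\<^sub>g\<close> of \<open>G\<close>, with the 1-automorphisms as kernel
  (\<open>lead_char_hom\<close>).

  Both homomorphisms have sections: \<open>\<Psi>\<close> by the first and \<open>x \<mapsto> \<rho>\<^sub>x\<close> by the second lifting
  property. A homomorphism with a section splits its source as an inner semidirect product of
  kernel and section, and doing this twice gives the inner decomposition into three factors; the
  multiplication map turns it into the outer one (\<open>semidirect3_of_retractions\<close>).

  It remains to restrict to strongly additive automorphisms. They form a group by assumption, and
  both sections take values in it: \<open>\<rho>\<^sub>x\<close> and the canonical lifts, as well as their inverses,
  compute each coefficient of the image from a single coefficient of the argument, so the images of
  the terms of a series add up to the image of the series (\<open>coefficientwise_strong\<close>); for a section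
  \<open>\<Psi>\<close> that is not canonical this is assumed. The argument applies to any group of strongly
  additive automorphisms that contains the sections, in particular to those mapping \<open>k\<close> onto itself,
  and with \<open>\<Phi>\<close> replaced by its second component to those fixing \<open>k\<close>. In the last two cases the
  internal parts agree: an internal automorphism that maps \<open>k\<close> onto itself fixes \<open>k\<close>
  (\<open>stab_coeff_IntAut\<close>).
\<close>


section \<open>Semidirect products from retractions\<close>

text \<open>A structure \<open>Q\<close> with a homomorphism from a group that has a multiplicative section is a
  homomorphic image of that group. So the group axioms of coefficient automorphisms, order
  automorphisms and \<open>Hom(G, k\<^sup>\<times>)\<close> come for free, once they are retracts of groups of
  automorphisms of \<open>K\<close>.\<close>

lemma group_of_retraction:
  assumes "group G" and \<phi>: "\<phi> \<in> hom G Q" and one: "\<phi> \<one>\<^bsub>G\<^esub> = \<one>\<^bsub>Q\<^esub>"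
    and \<psi>: "\<psi> \<in> hom Q G" and section_eq: "\<And>q. q \<in> carrier Q \<Longrightarrow> \<phi> (\<psi> q) = q"
  shows "group Q"
proof -
  interpret group G by fact
  have "\<phi> ` carrier G = carrier Q"
  proof
    show "\<phi> ` carrier G \<subseteq> carrier Q" using \<phi> by (auto simp: hom_def)
    show "carrier Q \<subseteq> \<phi> ` carrier G"
    proof
      fix q assume "q \<in> carrier Q"
      then show "q \<in> \<phi> ` carrier G"
        using \<psi> section_eq[of q] by (intro image_eqI[of _ _ "\<psi> q"]) (auto simp: hom_def)
    qed
  qed
  then show ?thesis
    using hom_imp_img_group[OF \<phi>] one by simp
qed

text \<open>This makes an outer semidirect product a group without checking associativity by hand: the
  group laws are carried back along the multiplication map \<open>(n, h) \<mapsto> n h\<close>.\<close>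

lemma group_of_iso:
  assumes f: "f \<in> iso S G"
    and closed: "\<And>p q. p \<in> carrier S \<Longrightarrow> q \<in> carrier S \<Longrightarrow> p \<otimes>\<^bsub>S\<^esub> q \<in> carrier S"
    and "group G" and one: "f \<one>\<^bsub>S\<^esub> = \<one>\<^bsub>G\<^esub>" "\<one>\<^bsub>S\<^esub> \<in> carrier S"
  shows "group S"
proof -
  interpret group G by fact
  have bij: "bij_betw f (carrier S) (carrier G)"
    and mult: "\<And>p q. p \<in> carrier S \<Longrightarrow> q \<in> carrier S \<Longrightarrow> f (p \<otimes>\<^bsub>S\<^esub> q) = f p \<otimes>\<^bsub>G\<^esub> f q"
    using f by (auto simp: iso_def hom_def)
  let ?g = "inv_into (carrier S) f"
  have g: "?g x \<in> carrier S" "f (?g x) = x" if "x \<in> carrier G" for x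
    using bij that by (auto simp: bij_betw_def f_inv_into_f inv_into_into)
  have gf: "?g (f p) = p" if "p \<in> carrier S" for p
    using bij that by (auto simp: bij_betw_def)
  have "?g \<in> hom G S"
  proof (rule homI)
    fix x y assume "x \<in> carrier G" "y \<in> carrier G"
    then show "?g (x \<otimes>\<^bsub>G\<^esub> y) = ?g x \<otimes>\<^bsub>S\<^esub> ?g y"
      using gf[of "?g x \<otimes>\<^bsub>S\<^esub> ?g y"] by (simp add: g closed mult)
  qed (rule g)
  moreover have "?g ` carrier G = carrier S"
    using bij by (metis bij_betw_def bij_betw_inv_into)
  moreover have "?g \<one>\<^bsub>G\<^esub> = \<one>\<^bsub>S\<^esub>"
    using gf one by metis
  ultimately show ?thesis
    using hom_imp_img_group[of ?g S] by simp
qed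

text \<open>Every \<open>x\<close> factors as \<open>(x \<psi>(\<phi>(x))\<^sup>-\<^sup>1) \<cdot> \<psi>(\<phi>(x))\<close>, the first factor lying in the
  kernel; the factors are unique because \<open>\<phi>\<close> kills the kernel and is injective on the section.\<close>

lemma inner_semidirect_of_retraction:
  assumes "group G" and \<phi>: "\<phi> \<in> hom G Q" and one: "\<phi> \<one>\<^bsub>G\<^esub> = \<one>\<^bsub>Q\<^esub>"
    and \<psi>: "\<psi> \<in> hom Q G" and section_eq: "\<And>q. q \<in> carrier Q \<Longrightarrow> \<phi> (\<psi> q) = q"
  shows "inner_semidirect G (kernel G Q \<phi>) (\<psi> ` carrier Q)"
proof -
  interpret G: group G by fact
  interpret Q: group Q by (rule group_of_retraction[OF assms])
  interpret \<phi>: group_hom G Q \<phi> by unfold_locales (fact \<phi>)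
  interpret \<psi>: group_hom Q G \<psi> by unfold_locales (fact \<psi>)
  have "kernel G Q \<phi> \<inter> \<psi> ` carrier Q = {\<one>\<^bsub>G\<^esub>}"
  proof
    show "kernel G Q \<phi> \<inter> \<psi> ` carrier Q \<subseteq> {\<one>\<^bsub>G\<^esub>}"
      by (auto simp: kernel_def section_eq)
    show "{\<one>\<^bsub>G\<^esub>} \<subseteq> kernel G Q \<phi> \<inter> \<psi> ` carrier Q"
      using image_eqI[of "\<one>\<^bsub>G\<^esub>" \<psi> "\<one>\<^bsub>Q\<^esub>" "carrier Q"] by (simp add: kernel_def)
  qed
  moreover have "kernel G Q \<phi> <#>\<^bsub>G\<^esub> \<psi> ` carrier Q = carrier G"
  proof
    show "carrier G \<subseteq> kernel G Q \<phi> <#>\<^bsub>G\<^esub> \<psi> ` carrier Q"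
    proof
      fix x assume x: "x \<in> carrier G"
      let ?y = "\<psi> (\<phi> x)"
      have "\<phi> (x \<otimes>\<^bsub>G\<^esub> inv\<^bsub>G\<^esub> ?y) = \<one>\<^bsub>Q\<^esub>"
        using x section_eq[of "\<phi> x"] by simp
      then have k: "x \<otimes>\<^bsub>G\<^esub> inv\<^bsub>G\<^esub> ?y \<in> kernel G Q \<phi>"
        using x by (simp add: kernel_def)
      have y: "?y \<in> \<psi> ` carrier Q" using x by simp
      have "x = (x \<otimes>\<^bsub>G\<^esub> inv\<^bsub>G\<^esub> ?y) \<otimes>\<^bsub>G\<^esub> ?y"
        using x by (simp add: G.m_assoc)
      then show "x \<in> kernel G Q \<phi> <#>\<^bsub>G\<^esub> \<psi> ` carrier Q"
        unfolding set_mult_def by (intro UN_I[OF k] UN_I[OF y]) simp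
    qed
  qed (auto simp: set_mult_def kernel_def)
  ultimately show ?thesis
    unfolding inner_semidirect_def
    using G.is_group \<phi>.normal_kernel \<psi>.img_is_subgroup by auto
qed

text \<open>The passage from an inner to an outer semidirect product. The normal factor is only given up
  to an isomorphism \<open>i\<close>, since in a product of three factors it is itself an outer product.\<close>

lemma semidirect_of_inner:
  assumes U: "group U" and A: "subgroup A U"
    and split: "inner_semidirect (U\<lparr>carrier := A\<rparr>) N X"
    and i: "i \<in> iso P (U\<lparr>carrier := N\<rparr>)"
    and "group P" and "group H" and j: "j \<in> iso H (U\<lparr>carrier := X\<rparr>)"
  defines "\<beta> \<equiv> conj_action U P i j"
  shows "\<beta> \<in> hom H (AutoGroup P)"
    and "(\<lambda>(p, h). i p \<otimes>\<^bsub>U\<^esub> j h) \<in> iso (semidirect P H \<beta>) (U\<lparr>carrier := A\<rparr>)"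
    and "group (semidirect P H \<beta>)"
proof -
  interpret U: group U by fact
  interpret P: group P by fact
  interpret H: group H by fact
  interpret A: subgroup A U by fact
  have normal: "N \<lhd> U\<lparr>carrier := A\<rparr>" and XA: "subgroup X (U\<lparr>carrier := A\<rparr>)"
    and disjoint: "N \<inter> X = {\<one>\<^bsub>U\<^esub>}" and generate: "N <#>\<^bsub>U\<^esub> X = A"
    using split by (auto simp: inner_semidirect_def)
  have NA: "subgroup N (U\<lparr>carrier := A\<rparr>)" using normal by (rule normal_imp_subgroup)
  interpret N: subgroup N U using U.incl_subgroup[OF A NA] .
  interpret X: subgroup X U using U.incl_subgroup[OF A XA] .
  have sub: "N \<subseteq> A" "X \<subseteq> A"
    using subgroup.subset[OF NA] subgroup.subset[OF XA] by simp_all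
  have conj: "x \<otimes>\<^bsub>U\<^esub> n \<otimes>\<^bsub>U\<^esub> inv\<^bsub>U\<^esub> x \<in> N" if "x \<in> X" "n \<in> N" for x n
    using normal.inv_op_closed2[OF normal, of x n] U.m_inv_consistent[OF A, of x] that sub by auto
  have i_bij: "bij_betw i (carrier P) N" and i_mult: "\<And>p q. p \<in> carrier P \<Longrightarrow> q \<in> carrier P \<Longrightarrow>
      i (p \<otimes>\<^bsub>P\<^esub> q) = i p \<otimes>\<^bsub>U\<^esub> i q"
    using i by (auto simp: iso_def hom_def)
  have j_bij: "bij_betw j (carrier H) X" and j_mult: "\<And>p q. p \<in> carrier H \<Longrightarrow> q \<in> carrier H \<Longrightarrow>
      j (p \<otimes>\<^bsub>H\<^esub> q) = j p \<otimes>\<^bsub>U\<^esub> j q"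
    using j by (auto simp: iso_def hom_def)
  have iN: "i p \<in> N" if "p \<in> carrier P" for p using i_bij that by (auto simp: bij_betw_def)
  have jX: "j h \<in> X" if "h \<in> carrier H" for h using j_bij that by (auto simp: bij_betw_def)
  have i_inj: "p = q" if "i p = i q" "p \<in> carrier P" "q \<in> carrier P" for p q
    using i_bij that by (auto simp: bij_betw_def inj_on_def)
  have iU[simp]: "i p \<in> carrier U" if "p \<in> carrier P" for p using iN[OF that] by simp
  have jU[simp]: "j h \<in> carrier U" if "h \<in> carrier H" for h using jX[OF that] by simp
  have \<beta>_P: "\<beta> h p \<in> carrier P"
    and i_\<beta>: "i (\<beta> h p) = j h \<otimes>\<^bsub>U\<^esub> i p \<otimes>\<^bsub>U\<^esub> inv\<^bsub>U\<^esub> (j h)"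
    if "h \<in> carrier H" "p \<in> carrier P" for h p
  proof -
    have "j h \<otimes>\<^bsub>U\<^esub> i p \<otimes>\<^bsub>U\<^esub> inv\<^bsub>U\<^esub> (j h) \<in> i ` carrier P"
      using conj[OF jX iN] that i_bij by (auto simp: bij_betw_def)
    then show "\<beta> h p \<in> carrier P" "i (\<beta> h p) = j h \<otimes>\<^bsub>U\<^esub> i p \<otimes>\<^bsub>U\<^esub> inv\<^bsub>U\<^esub> (j h)"
      using that by (auto simp: \<beta>_def conj_action_def inv_into_into f_inv_into_f)
  qed
  have cancel: "inv\<^bsub>U\<^esub> x \<otimes>\<^bsub>U\<^esub> (x \<otimes>\<^bsub>U\<^esub> y) = y" if "x \<in> carrier U" "y \<in> carrier U" for x y
    using that by (simp flip: U.m_assoc)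
  have \<beta>_mult: "\<beta> h (p \<otimes>\<^bsub>P\<^esub> q) = \<beta> h p \<otimes>\<^bsub>P\<^esub> \<beta> h q"
    if "h \<in> carrier H" "p \<in> carrier P" "q \<in> carrier P" for h p q
    by (rule i_inj) (use that in \<open>simp_all add: \<beta>_P i_\<beta> i_mult U.m_assoc cancel\<close>)
  have \<beta>_comp: "\<beta> (h \<otimes>\<^bsub>H\<^esub> h') p = \<beta> h (\<beta> h' p)"
    if "h \<in> carrier H" "h' \<in> carrier H" "p \<in> carrier P" for h h' p
    by (rule i_inj)
      (use that in \<open>simp_all add: \<beta>_P i_\<beta> j_mult U.m_assoc U.inv_mult_group\<close>)
  have j_one: "j \<one>\<^bsub>H\<^esub> = \<one>\<^bsub>U\<^esub>"
    using j_mult[of "\<one>\<^bsub>H\<^esub>" "\<one>\<^bsub>H\<^esub>"] by (metis H.one_closed H.l_one U.l_cancel_one jU)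
  have \<beta>_one: "\<beta> \<one>\<^bsub>H\<^esub> p = p" if "p \<in> carrier P" for p
    by (rule i_inj) (use that in \<open>simp_all add: \<beta>_P i_\<beta> j_one\<close>)
  have \<beta>_bij: "bij_betw (\<beta> h) (carrier P) (carrier P)" if h: "h \<in> carrier H" for h
    by (rule bij_betw_byWitness[where f' = "\<beta> (inv\<^bsub>H\<^esub> h)"])
      (auto simp: h \<beta>_P \<beta>_one simp flip: \<beta>_comp)
  have \<beta>_auto: "\<beta> h \<in> auto P" if "h \<in> carrier H" for h
    using that \<beta>_bij \<beta>_P \<beta>_mult
    by (auto simp: auto_def hom_def Bij_def) (simp add: \<beta>_def conj_action_def)
  show "\<beta> \<in> hom H (AutoGroup P)"
  proof (rule homI)
    fix h h' assume h: "h \<in> carrier H" "h' \<in> carrier H"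
    have "\<beta> (h \<otimes>\<^bsub>H\<^esub> h') = compose (carrier P) (\<beta> h) (\<beta> h')"
    proof (rule extensionalityI[where A = "carrier P"])
      show "\<beta> (h \<otimes>\<^bsub>H\<^esub> h') \<in> extensional (carrier P)"
        by (simp add: \<beta>_def conj_action_def)
    qed (auto simp: h \<beta>_comp compose_def)
    then show "\<beta> (h \<otimes>\<^bsub>H\<^esub> h') = \<beta> h \<otimes>\<^bsub>AutoGroup P\<^esub> \<beta> h'"
      using \<beta>_auto h by (auto simp: AutoGroup_def BijGroup_def auto_def)
  qed (use \<beta>_auto in \<open>simp add: AutoGroup_def\<close>)
  have closed: "p \<otimes>\<^bsub>semidirect P H \<beta>\<^esub> q \<in> carrier (semidirect P H \<beta>)"
    if "p \<in> carrier (semidirect P H \<beta>)" "q \<in> carrier (semidirect P H \<beta>)" for p q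
    using that by (auto simp: semidirect_def \<beta>_P)
  show iso: "(\<lambda>(p, h). i p \<otimes>\<^bsub>U\<^esub> j h) \<in> iso (semidirect P H \<beta>) (U\<lparr>carrier := A\<rparr>)"
  proof (rule isoI)
    show "(\<lambda>(p, h). i p \<otimes>\<^bsub>U\<^esub> j h) \<in> hom (semidirect P H \<beta>) (U\<lparr>carrier := A\<rparr>)"
    proof (rule homI)
      fix x y assume "x \<in> carrier (semidirect P H \<beta>)" "y \<in> carrier (semidirect P H \<beta>)"
      then show "(\<lambda>(p, h). i p \<otimes>\<^bsub>U\<^esub> j h) (x \<otimes>\<^bsub>semidirect P H \<beta>\<^esub> y) =
          (\<lambda>(p, h). i p \<otimes>\<^bsub>U\<^esub> j h) x \<otimes>\<^bsub>U\<lparr>carrier := A\<rparr>\<^esub> (\<lambda>(p, h). i p \<otimes>\<^bsub>U\<^esub> j h) y"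
        by (auto simp: semidirect_def i_mult j_mult \<beta>_P i_\<beta> U.m_assoc cancel)
    next
      fix x assume "x \<in> carrier (semidirect P H \<beta>)"
      then show "(\<lambda>(p, h). i p \<otimes>\<^bsub>U\<^esub> j h) x \<in> carrier (U\<lparr>carrier := A\<rparr>)"
        using A.m_closed[OF subsetD[OF sub(1) iN] subsetD[OF sub(2) jX]] by (auto simp: semidirect_def)
    qed
    show "bij_betw (\<lambda>(p, h). i p \<otimes>\<^bsub>U\<^esub> j h)
        (carrier (semidirect P H \<beta>)) (carrier (U\<lparr>carrier := A\<rparr>))"
      unfolding bij_betw_def
    proof
      have "(\<lambda>(p, h). i p \<otimes>\<^bsub>U\<^esub> j h) ` (carrier P \<times> carrier H) = N <#>\<^bsub>U\<^esub> X"
        using i_bij j_bij by (force simp: set_mult_def bij_betw_def)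
      then show "(\<lambda>(p, h). i p \<otimes>\<^bsub>U\<^esub> j h) ` carrier (semidirect P H \<beta>) = carrier (U\<lparr>carrier := A\<rparr>)"
        by (simp add: semidirect_def generate)
      show "inj_on (\<lambda>(p, h). i p \<otimes>\<^bsub>U\<^esub> j h) (carrier (semidirect P H \<beta>))"
      proof (rule inj_onI, clarsimp simp: semidirect_def)
        fix p h q l assume mem: "p \<in> carrier P" "q \<in> carrier P" "h \<in> carrier H" "l \<in> carrier H"
          and eq: "i p \<otimes>\<^bsub>U\<^esub> j h = i q \<otimes>\<^bsub>U\<^esub> j l"
        have "inv\<^bsub>U\<^esub> (i q) \<otimes>\<^bsub>U\<^esub> i p = j l \<otimes>\<^bsub>U\<^esub> inv\<^bsub>U\<^esub> (j h)" (is "?n = ?x")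
        proof -
          have "?n = inv\<^bsub>U\<^esub> (i q) \<otimes>\<^bsub>U\<^esub> (i p \<otimes>\<^bsub>U\<^esub> j h) \<otimes>\<^bsub>U\<^esub> inv\<^bsub>U\<^esub> (j h)"
            using mem by (simp add: U.m_assoc)
          also have "\<dots> = ?x" using mem by (simp add: eq U.m_assoc[symmetric])
          finally show ?thesis .
        qed
        moreover have "?n \<in> N" "?x \<in> X" using mem iN jX by auto
        ultimately have "?n = \<one>\<^bsub>U\<^esub>" "?x = \<one>\<^bsub>U\<^esub>" using disjoint by auto
        then have "inv\<^bsub>U\<^esub> (inv\<^bsub>U\<^esub> (i q)) = i p" "inv\<^bsub>U\<^esub> (inv\<^bsub>U\<^esub> (j h)) = j l"
          using mem U.inv_equality[of "i p" "inv\<^bsub>U\<^esub> (i q)"] U.inv_equality[of "j l" "inv\<^bsub>U\<^esub> (j h)"]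
            U.inv_comm by simp_all
        then have "i p = i q" "j l = j h"
          using mem by simp_all
        then show "p = q \<and> h = l"
          using mem i_inj j_bij by (auto simp: bij_betw_def inj_on_def)
      qed
    qed
  qed
  have i_one: "i \<one>\<^bsub>P\<^esub> = \<one>\<^bsub>U\<^esub>"
    using i_mult[of "\<one>\<^bsub>P\<^esub>" "\<one>\<^bsub>P\<^esub>"] by (metis P.one_closed P.l_one U.l_cancel_one iU)
  show "group (semidirect P H \<beta>)"
    by (rule group_of_iso[OF iso closed U.subgroup_imp_group[OF A]])
      (auto simp: semidirect_def i_one j_one)
qed

text \<open>The pattern shared by all three decompositions: split off the image of \<open>\<phi>\<close> from \<open>A\<close>, then the
  image of \<open>\<chi>\<close> from the kernel \<open>B\<close> of \<open>\<phi>\<close>.\<close>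

lemma semidirect3_of_retractions:
  assumes "group U" and A: "subgroup A U"
    and \<phi>: "\<phi> \<in> hom (U\<lparr>carrier := A\<rparr>) Q" "\<phi> \<one>\<^bsub>U\<^esub> = \<one>\<^bsub>Q\<^esub>"
    and \<psi>: "\<psi> \<in> hom Q (U\<lparr>carrier := A\<rparr>)" "\<And>q. q \<in> carrier Q \<Longrightarrow> \<phi> (\<psi> q) = q"
    and B: "kernel (U\<lparr>carrier := A\<rparr>) Q \<phi> = B"
    and \<chi>: "\<chi> \<in> hom (U\<lparr>carrier := B\<rparr>) E" "\<chi> \<one>\<^bsub>U\<^esub> = \<one>\<^bsub>E\<^esub>"
    and e: "e \<in> hom E (U\<lparr>carrier := B\<rparr>)" "\<And>x. x \<in> carrier E \<Longrightarrow> \<chi> (e x) = x"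
    and N: "kernel (U\<lparr>carrier := B\<rparr>) E \<chi> = N"
  shows "inner_semidirect3 U A N (e ` carrier E) (\<psi> ` carrier Q)"
    and "outer_semidirect3 U A N E e Q \<psi>"
proof -
  interpret U: group U by fact
  have gA: "group (U\<lparr>carrier := A\<rparr>)" using A by (rule U.subgroup_imp_group)
  have outer: "inner_semidirect (U\<lparr>carrier := A\<rparr>) B (\<psi> ` carrier Q)"
    using inner_semidirect_of_retraction[OF gA, of \<phi> Q \<psi>] \<phi> \<psi> B by simp
  have gQ: "group Q"
    using group_of_retraction[OF gA, of \<phi> Q \<psi>] \<phi> \<psi> by simp
  have subB: "subgroup B U"
    using outer U.incl_subgroup[OF A] normal_imp_subgroup by (auto simp: inner_semidirect_def)
  have gB: "group (U\<lparr>carrier := B\<rparr>)" using subB by (rule U.subgroup_imp_group)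
  have inner: "inner_semidirect (U\<lparr>carrier := B\<rparr>) N (e ` carrier E)"
    using inner_semidirect_of_retraction[OF gB, of \<chi> E e] \<chi> e N by simp
  have gE: "group E"
    using group_of_retraction[OF gB, of \<chi> E e] \<chi> e by simp
  have prod: "N <#>\<^bsub>U\<^esub> e ` carrier E = B"
    using inner by (simp add: inner_semidirect_def)
  show "inner_semidirect3 U A N (e ` carrier E) (\<psi> ` carrier Q)"
    using outer inner by (simp add: inner_semidirect3_def prod)
  have subN: "subgroup N U"
    using inner U.incl_subgroup[OF subB] normal_imp_subgroup by (auto simp: inner_semidirect_def)
  have iso_e: "e \<in> iso E (U\<lparr>carrier := e ` carrier E\<rparr>)"
    using e by (auto simp: iso_def hom_def bij_betw_def intro: inj_on_inverseI)
  have iso_\<psi>: "\<psi> \<in> iso Q (U\<lparr>carrier := \<psi> ` carrier Q\<rparr>)"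
    using \<psi> by (auto simp: iso_def hom_def bij_betw_def intro: inj_on_inverseI)
  have iso_N: "(\<lambda>n. n) \<in> iso (U\<lparr>carrier := N\<rparr>) (U\<lparr>carrier := N\<rparr>)"
    by (auto simp: iso_def hom_def bij_betw_def)
  have gN: "group (U\<lparr>carrier := N\<rparr>)" using subN by (rule U.subgroup_imp_group)
  note first = semidirect_of_inner[OF \<open>group U\<close> subB inner iso_N gN gE iso_e]
  note second = semidirect_of_inner[OF \<open>group U\<close> A outer first(2) first(3) gQ iso_\<psi>]
  show "outer_semidirect3 U A N E e Q \<psi>"
    unfolding outer_semidirect3_def Let_def
    using first(1) second(1) group.iso_sym[OF second(3) is_isoI[OF second(2)]] by blast
qed


section \<open>Leading coefficients of formal series\<close>

lemma coeff_val:
  assumes "well_ordered (supp a)" "a \<noteq> (\<lambda>g. 0)"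
  shows "a (val a) \<noteq> 0" and "h < val a \<Longrightarrow> a h = 0"
proof -
  have "supp a \<noteq> {}" using assms(2) by (auto simp: supp_def)
  then obtain m where m: "m \<in> supp a" "\<forall>x\<in>supp a. m \<le> x"
    using assms(1) by (auto simp: well_ordered_def)
  then have "val a = m" unfolding val_def by (intro Least_equality) auto
  with m show "a (val a) \<noteq> 0" "h < val a \<Longrightarrow> a h = 0"
    by (auto simp: supp_def not_less[symmetric])
qed

lemma val_mon [simp]: "c \<noteq> 0 \<Longrightarrow> val (mon c g) = g"
  unfolding val_def by (rule Least_equality) (auto simp: supp_def mon_def split: if_splits)

lemma mon_eq_0_iff: "mon c g = (\<lambda>h. 0) \<longleftrightarrow> c = 0"
  by (auto simp: mon_def fun_eq_iff)

lemma supp_mon_subset: "supp (mon c g) \<subseteq> {g}"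
  by (auto simp: supp_def mon_def)

lemma well_ordered_finite: "finite S \<Longrightarrow> well_ordered S" for S :: "'g::linorder set"
  unfolding well_ordered_def by (metis Min_in Min_le finite_subset)

text \<open>If \<open>a\<close> vanishes below \<open>g\<close> and \<open>b\<close> below \<open>g'\<close>, the only summand of the convolution at \<open>g + g'\<close>
  that can survive is the one at \<open>h = g\<close>. Vanishing below a bound, rather than having it as
  value, lets the zero series and vanishing leading terms be treated uniformly.\<close>

lemma conv_lead:
  fixes a b :: "'g::linordered_ab_group_add \<Rightarrow> 'k::field"
  assumes "\<And>h. h < g \<Longrightarrow> a h = 0" and "\<And>h. h < g' \<Longrightarrow> b h = 0"
  shows "conv a b (g + g') = a g * b g'"
proof -
  have "{h. h \<in> supp a \<and> g + g' - h \<in> supp b} \<subseteq> {g}"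
  proof safe
    fix h assume "h \<in> supp a" "g + g' - h \<in> supp b"
    then have "g \<le> h" "g' \<le> g + g' - h"
      using assms by (auto simp: supp_def not_less[symmetric])
    then show "h = g" by (simp add: le_diff_eq)
  qed
  then have "conv a b (g + g') = (\<Sum>h\<in>{g}. a h * b (g + g' - h))"
    unfolding conv_def by (intro sum.mono_neutral_left) (auto simp: supp_def)
  then show ?thesis by simp
qed

lemma conv_mon:
  fixes c d :: "'k::field" and g g' :: "'g::linordered_ab_group_add"
  shows "conv (mon c g) (mon d g') = mon (c * d) (g + g')"
proof
  fix x
  have "conv (mon c g) (mon d g') x = (\<Sum>h\<in>{g}. mon c g h * mon d g' (x - h))"
    unfolding conv_def by (intro sum.mono_neutral_left) (auto simp: supp_def mon_def split: if_splits)
  then show "conv (mon c g) (mon d g') x = mon (c * d) (g + g') x"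
    by (auto simp: mon_def)
qed

lemma conv_one:
  fixes a :: "'g::linordered_ab_group_add \<Rightarrow> 'k::field"
  shows "conv (mon 1 0) a = a" and "conv a (mon 1 0) = a"
proof -
  show "conv (mon 1 0) a = a"
  proof
    fix x
    have "conv (mon 1 0) a x = (\<Sum>h\<in>{0}. mon 1 0 h * a (x - h))"
      unfolding conv_def by (intro sum.mono_neutral_left) (auto simp: supp_def mon_def split: if_splits)
    then show "conv (mon 1 0) a x = a x" by (simp add: mon_def)
  qed
  show "conv a (mon 1 0) = a"
  proof
    fix x
    have "conv a (mon 1 0) x = (\<Sum>h\<in>{x}. a h * mon 1 0 (x - h))"
      unfolding conv_def by (intro sum.mono_neutral_left) (auto simp: supp_def mon_def split: if_splits)
    then show "conv a (mon 1 0) x = a x" by (simp add: mon_def)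
  qed
qed


section \<open>The groups of maps involved\<close>

lemma BijGroup_mult_apply:
  assumes "\<sigma> \<in> Bij K" "\<tau> \<in> Bij K" "a \<in> K"
  shows "(\<sigma> \<otimes>\<^bsub>BijGroup K\<^esub> \<tau>) a = \<sigma> (\<tau> a)"
  using assms by (simp add: BijGroup_def compose_def)

lemma Bij_inverse:
  assumes "\<sigma> \<in> Bij K" "a \<in> K"
  shows "(inv\<^bsub>BijGroup K\<^esub> \<sigma>) a \<in> K" and "\<sigma> ((inv\<^bsub>BijGroup K\<^esub> \<sigma>) a) = a"
    and "(inv\<^bsub>BijGroup K\<^esub> \<sigma>) (\<sigma> a) = a" and "\<sigma> a \<in> K"
  using assms
  by (auto simp: inv_BijGroup Bij_def bij_betw_def inv_into_into f_inv_into_f)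

lemma in_AutCoeff_iff:
  "\<rho> \<in> carrier AutCoeff \<longleftrightarrow> bij \<rho> \<and> (\<forall>c d. \<rho> (c + d) = \<rho> c + \<rho> d) \<and>
     (\<forall>c d. \<rho> (c * d) = \<rho> c * \<rho> d) \<and> \<rho> 1 = 1"
  by (simp add: AutCoeff_def)

lemma in_oAut_iff:
  "\<tau> \<in> carrier oAut \<longleftrightarrow> bij \<tau> \<and> (\<forall>g h. \<tau> (g + h) = \<tau> g + \<tau> h) \<and> strict_mono \<tau>"
  by (simp add: oAut_def)

lemma AutCoeff_simps:
  "\<rho> \<in> carrier AutCoeff \<Longrightarrow> \<rho>' \<in> carrier AutCoeff \<Longrightarrow> \<rho> \<otimes>\<^bsub>AutCoeff\<^esub> \<rho>' = \<rho> \<circ> \<rho>'"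
  "\<one>\<^bsub>AutCoeff\<^esub> = id"
  by (auto simp: AutCoeff_def BijGroup_def Bij_def compose_def fun_eq_iff)

lemma oAut_simps:
  "\<tau> \<in> carrier oAut \<Longrightarrow> \<tau>' \<in> carrier oAut \<Longrightarrow> \<tau> \<otimes>\<^bsub>oAut\<^esub> \<tau>' = \<tau> \<circ> \<tau>'"
  "\<one>\<^bsub>oAut\<^esub> = id"
  by (auto simp: oAut_def BijGroup_def Bij_def compose_def fun_eq_iff)

definition lead_char :: "(('g \<Rightarrow> 'k::zero_neq_one) \<Rightarrow> 'g \<Rightarrow> 'k) \<Rightarrow> 'g \<Rightarrow> 'k" where
  "lead_char \<sigma> = (\<lambda>g. \<sigma> (mon 1 g) g)"


section \<open>Valuation preserving automorphisms on leading terms\<close>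

locale hahn_subfield =
  fixes K :: "('g::linordered_ab_group_add \<Rightarrow> 'k::field) set"
  assumes hahn_field: "hahn_field K"
begin

lemma well_ordered_supp: "a \<in> K \<Longrightarrow> well_ordered (supp a)"
  and add_closed: "a \<in> K \<Longrightarrow> b \<in> K \<Longrightarrow> (\<lambda>g. a g + b g) \<in> K"
proof -
  have K: "subgroup K (add_monoid hahn)"
    using hahn_field unfolding hahn_field_def
    by (meson subcring.axioms(1) subdomain.axioms(1) subfield.axioms(1) subring.axioms(1))
  show "a \<in> K \<Longrightarrow> well_ordered (supp a)"
    using subgroup.subset[OF K] by (auto simp: hahn_def)
  show "a \<in> K \<Longrightarrow> b \<in> K \<Longrightarrow> (\<lambda>g. a g + b g) \<in> K"
    using subgroup.m_closed[OF K, of a b] by (simp add: hahn_def)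
qed

text \<open>Monomials lie in \<open>k(G)\<close> as fractions with denominator \<open>1\<close>.\<close>

lemma mon_closed: "mon c g \<in> K"
proof -
  have wo: "well_ordered (supp (mon 1 0 :: 'g \<Rightarrow> 'k))"
    by (rule well_ordered_finite) (rule finite_subset[OF supp_mon_subset], simp)
  have "inv\<^bsub>hahn\<^esub> \<one>\<^bsub>hahn\<^esub> = (\<one>\<^bsub>hahn\<^esub> :: 'g \<Rightarrow> 'k)"
    unfolding m_inv_def
    by (rule the_equality) (use wo in \<open>auto simp: hahn_def conv_one\<close>)
  then have "mon c g = mon c g \<otimes>\<^bsub>hahn\<^esub> inv\<^bsub>hahn\<^esub> (\<one>\<^bsub>hahn\<^esub> :: 'g \<Rightarrow> 'k)"
    by (simp add: hahn_def conv_one)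
  moreover have "mon c g \<in> group_ring" "(\<one>\<^bsub>hahn\<^esub> :: 'g \<Rightarrow> 'k) \<in> group_ring"
    by (auto simp: group_ring_def hahn_def intro: finite_subset[OF supp_mon_subset])
  moreover have "(\<one>\<^bsub>hahn\<^esub> :: 'g \<Rightarrow> 'k) \<noteq> \<zero>\<^bsub>hahn\<^esub>"
    by (simp add: hahn_def mon_eq_0_iff)
  ultimately have "mon c g \<in> group_ring_fractions"
    unfolding group_ring_fractions_def by blast
  then show ?thesis using hahn_field by (auto simp: hahn_field_def)
qed

lemma zero_closed: "(\<lambda>g. 0) \<in> K"
  using mon_closed[of 0 0] by (simp add: mon_def)

lemma vAut_Bij: "\<sigma> \<in> vAut K \<Longrightarrow> \<sigma> \<in> Bij K"
  by (auto simp: vAut_def ring_iso_def Bij_def)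

lemma
  assumes \<sigma>: "\<sigma> \<in> vAut K"
  shows vAut_add: "a \<in> K \<Longrightarrow> b \<in> K \<Longrightarrow> \<sigma> (\<lambda>g. a g + b g) = (\<lambda>g. \<sigma> a g + \<sigma> b g)"
    and vAut_mult: "a \<in> K \<Longrightarrow> b \<in> K \<Longrightarrow> \<sigma> (conv a b) = conv (\<sigma> a) (\<sigma> b)"
    and vAut_one: "\<sigma> (mon 1 0) = mon 1 0"
    and vAut_closed: "a \<in> K \<Longrightarrow> \<sigma> a \<in> K"
  using \<sigma> by (auto simp: vAut_def ring_iso_def ring_hom_def hahn_def)

lemma vAut_zero: assumes "\<sigma> \<in> vAut K" shows "\<sigma> (\<lambda>g. 0) = (\<lambda>g. 0)"
proof
  fix g
  show "\<sigma> (\<lambda>g. 0) g = 0"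
    using fun_cong[OF vAut_add[OF assms zero_closed zero_closed], of g]
    by (simp only: add_0_left add_cancel_right_left)
qed

lemma vAut_eq_0_iff:
  assumes "\<sigma> \<in> vAut K" "a \<in> K" shows "\<sigma> a = (\<lambda>g. 0) \<longleftrightarrow> a = (\<lambda>g. 0)"
  using assms vAut_zero[OF assms(1)] vAut_Bij[OF assms(1)] zero_closed
  by (metis Bij_inverse(3))

lemma
  assumes \<sigma>: "\<sigma> \<in> vAut K"
  shows value_part_oAut: "value_part K \<sigma> \<in> carrier oAut"
    and value_part_val: "a \<in> K \<Longrightarrow> a \<noteq> (\<lambda>g. 0) \<Longrightarrow> val (\<sigma> a) = value_part K \<sigma> (val a)"
    and value_part_unique: "\<And>\<tau>. (\<And>g. \<tau> g = val (\<sigma> (mon 1 g))) \<Longrightarrow> value_part K \<sigma> = \<tau>"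
proof -
  let ?P = "\<lambda>\<tau>. \<tau> \<in> carrier oAut \<and> (\<forall>a\<in>K - {\<zero>\<^bsub>hahn\<^esub>}. \<tau> (val a) = val (\<sigma> a))"
  have val_on_mon: "\<tau> g = val (\<sigma> (mon 1 g))" if "?P \<tau>" for \<tau> g
    using that bspec[of "K - {\<zero>\<^bsub>hahn\<^esub>}" "\<lambda>a. \<tau> (val a) = val (\<sigma> a)" "mon 1 g"]
    by (simp add: hahn_def mon_closed mon_eq_0_iff)
  obtain \<tau> where \<tau>: "?P \<tau>" using \<sigma> by (auto simp: vAut_def)
  have "value_part K \<sigma> = \<tau>" unfolding value_part_def
  proof (rule the_equality[where P = ?P, OF \<tau>])
    show "\<tau>' = \<tau>" if "?P \<tau>'" for \<tau>'
      using val_on_mon[OF \<tau>] val_on_mon[OF that] by (simp add: fun_eq_iff)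
  qed
  with \<tau> have P: "?P (value_part K \<sigma>)" by simp
  then show "value_part K \<sigma> \<in> carrier oAut"
    and "a \<in> K \<Longrightarrow> a \<noteq> (\<lambda>g. 0) \<Longrightarrow> val (\<sigma> a) = value_part K \<sigma> (val a)"
    by (auto simp: hahn_def)
  show "value_part K \<sigma> = \<tau>" if "\<And>g. \<tau> g = val (\<sigma> (mon 1 g))" for \<tau>
    using val_on_mon[OF P] that by (simp add: fun_eq_iff)
qed

lemma value_part_less_iff:
  assumes "\<sigma> \<in> vAut K" shows "value_part K \<sigma> g < value_part K \<sigma> h \<longleftrightarrow> g < h"
  using value_part_oAut[OF assms] by (simp add: in_oAut_iff strict_mono_less)

lemma value_part_add:
  assumes "\<sigma> \<in> vAut K" shows "value_part K \<sigma> (g + h) = value_part K \<sigma> g + value_part K \<sigma> h"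
  using value_part_oAut[OF assms] by (simp add: in_oAut_iff)

lemma value_part_0:
  assumes "\<sigma> \<in> vAut K" shows "value_part K \<sigma> 0 = 0"
  using value_part_add[OF assms, of 0 0] by simp

lemma vAut_vanish:
  assumes \<sigma>: "\<sigma> \<in> vAut K" and a: "a \<in> K" and vanish: "\<And>h. h < g \<Longrightarrow> a h = 0"
    and h: "h < value_part K \<sigma> g"
  shows "\<sigma> a h = 0"
proof (cases "a = (\<lambda>g. 0)")
  case True
  then show ?thesis using vAut_zero[OF \<sigma>] by simp
next
  case False
  then have "\<not> val a < g"
    using coeff_val(1)[OF well_ordered_supp[OF a]] vanish by blast
  then have "h < val (\<sigma> a)"
    using h value_part_less_iff[OF \<sigma>, of "val a" g] value_part_val[OF \<sigma> a False] by simp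
  then show ?thesis
    using coeff_val(2)[OF well_ordered_supp[OF vAut_closed[OF \<sigma> a]]] vAut_eq_0_iff[OF \<sigma> a] False by blast
qed

lemma vAut_vanish_mon:
  assumes "\<sigma> \<in> vAut K" "h < value_part K \<sigma> g" shows "\<sigma> (mon c g) h = 0"
  by (rule vAut_vanish[OF assms(1) mon_closed _ assms(2)]) (auto simp: mon_def)

text \<open>The formula on which everything rests: on the leading term, \<open>\<sigma>\<close> acts through its two
  components and the leading coefficients of the \<open>\<sigma>(t\<^sup>g)\<close>. Subtracting the term of \<open>a\<close> at \<open>g\<close>
  leaves a series of value beyond \<open>g\<close>, whose image has no coefficient at \<open>\<tau>(g)\<close>; the term itself
  is the product of a constant and \<open>t\<^sup>g\<close>, and leading coefficients multiply.\<close>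

lemma vAut_lead:
  assumes \<sigma>: "\<sigma> \<in> vAut K" and a: "a \<in> K" and vanish: "\<And>h. h < g \<Longrightarrow> a h = 0"
  defines "\<tau> \<equiv> value_part K \<sigma>"
  shows "\<sigma> a (\<tau> g) = coeff_part \<sigma> (a g) * \<sigma> (mon 1 g) (\<tau> g)"
proof -
  define b where "b = (\<lambda>h. a h + mon (- a g) g h)"
  have b: "b \<in> K" unfolding b_def by (intro add_closed a mon_closed)
  have b_vanish: "b h = 0" if "h \<le> g" for h
    using that vanish[of h] by (auto simp: b_def mon_def)
  have "\<sigma> b (\<tau> g) = 0"
  proof (cases "b = (\<lambda>g. 0)")
    case False
    then have "\<not> val b \<le> g"
      using coeff_val(1)[OF well_ordered_supp[OF b]] b_vanish by blast
    then have "\<tau> g < \<tau> (val b)"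
      using value_part_less_iff[OF \<sigma>, of g "val b"] by (simp add: \<tau>_def)
    then show ?thesis
      unfolding \<tau>_def
      by (intro vAut_vanish[OF \<sigma> b, of "val b"] coeff_val(2)[OF well_ordered_supp[OF b] False])
  qed (simp add: vAut_zero[OF \<sigma>])
  moreover have "(\<lambda>h. b h + mon (a g) g h) = a"
    by (auto simp: b_def mon_def fun_eq_iff)
  ultimately have "\<sigma> a (\<tau> g) = \<sigma> (mon (a g) g) (\<tau> g)"
    using vAut_add[OF \<sigma> b mon_closed, of "a g" g] by simp
  also have "mon (a g) g = conv (mon (a g) 0) (mon 1 g)"
    by (simp add: conv_mon)
  also have "\<sigma> \<dots> (\<tau> g) = \<sigma> (mon (a g) 0) 0 * \<sigma> (mon 1 g) (\<tau> g)"
    unfolding vAut_mult[OF \<sigma> mon_closed mon_closed]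
  proof (rule conv_lead[of 0 _ "\<tau> g", simplified])
    show "\<sigma> (mon (a g) 0) h = 0" if "h < 0" for h
      using that vAut_vanish_mon[OF \<sigma>, of h 0] by (simp add: value_part_0[OF \<sigma>])
    show "\<sigma> (mon 1 g) h = 0" if "h < \<tau> g" for h
      using that vAut_vanish_mon[OF \<sigma>, of h g] by (simp add: \<tau>_def)
  qed
  finally show ?thesis by (simp add: coeff_part_def)
qed

lemma lead_add:
  assumes \<sigma>: "\<sigma> \<in> vAut K"
  defines "\<tau> \<equiv> value_part K \<sigma>"
  shows "\<sigma> (mon 1 (g + h)) (\<tau> (g + h)) = \<sigma> (mon 1 g) (\<tau> g) * \<sigma> (mon 1 h) (\<tau> h)"
proof -
  have "\<sigma> (mon 1 (g + h)) = conv (\<sigma> (mon 1 g)) (\<sigma> (mon 1 h))"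
    using vAut_mult[OF \<sigma> mon_closed mon_closed, of 1 g 1 h] by (simp add: conv_mon)
  then show ?thesis
    unfolding \<tau>_def value_part_add[OF \<sigma>]
    using vAut_vanish_mon[OF \<sigma>] by (simp add: conv_lead)
qed

lemma lead_nonzero:
  assumes \<sigma>: "\<sigma> \<in> vAut K" shows "\<sigma> (mon 1 g) (value_part K \<sigma> g) \<noteq> 0"
  using coeff_val(1)[OF well_ordered_supp[OF vAut_closed[OF \<sigma> mon_closed]], of 1 g]
    value_part_val[OF \<sigma> mon_closed, of 1 g] vAut_eq_0_iff[OF \<sigma> mon_closed, of 1 g]
  by (simp add: mon_eq_0_iff)

lemma value_part_mult:
  assumes \<sigma>: "\<sigma> \<in> vAut K" and \<tau>: "\<tau> \<in> vAut K" and \<sigma>\<tau>: "\<sigma> \<otimes>\<^bsub>BijGroup K\<^esub> \<tau> \<in> vAut K"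
  shows "value_part K (\<sigma> \<otimes>\<^bsub>BijGroup K\<^esub> \<tau>) = value_part K \<sigma> \<circ> value_part K \<tau>"
  by (rule value_part_unique[OF \<sigma>\<tau>])
    (simp add: BijGroup_mult_apply vAut_Bij \<sigma> \<tau> mon_closed value_part_val vAut_closed
      vAut_eq_0_iff mon_eq_0_iff)

text \<open>The series \<open>\<tau>(c)\<close> need not be a constant, but by the leading term formula \<open>\<sigma>\<close> sees only its
  constant coefficient.\<close>

lemma coeff_part_mult:
  assumes \<sigma>: "\<sigma> \<in> vAut K" and \<tau>: "\<tau> \<in> vAut K"
  shows "coeff_part (\<sigma> \<otimes>\<^bsub>BijGroup K\<^esub> \<tau>) = coeff_part \<sigma> \<circ> coeff_part \<tau>"
proof
  fix c
  have "\<sigma> (\<tau> (mon c 0)) 0 = coeff_part \<sigma> (\<tau> (mon c 0) 0)"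
    using vAut_lead[OF \<sigma> vAut_closed[OF \<tau> mon_closed], of 0 c 0] vAut_vanish_mon[OF \<tau>, of _ 0]
    by (simp add: value_part_0 \<sigma> \<tau> vAut_one) (simp add: mon_def)
  then show "coeff_part (\<sigma> \<otimes>\<^bsub>BijGroup K\<^esub> \<tau>) c = (coeff_part \<sigma> \<circ> coeff_part \<tau>) c"
    by (simp add: coeff_part_def BijGroup_mult_apply vAut_Bij \<sigma> \<tau> mon_closed)
qed

lemma Phi_one: "Phi K \<one>\<^bsub>BijGroup K\<^esub> = (id, id)" if "\<one>\<^bsub>BijGroup K\<^esub> \<in> vAut K"
proof -
  have "value_part K \<one>\<^bsub>BijGroup K\<^esub> = id"
    by (rule value_part_unique[OF that]) (simp add: BijGroup_def mon_closed)
  then show ?thesis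
    by (simp add: Phi_def coeff_part_def BijGroup_def mon_closed fun_eq_iff) (simp add: mon_def)
qed

text \<open>Surjectivity on \<open>k\<close> comes from the inverse automorphism, whose induced map on \<open>k\<close> is a
  two-sided inverse; hence the assumption that the inverse is valuation preserving too.\<close>

lemma coeff_part_AutCoeff:
  assumes \<sigma>: "\<sigma> \<in> vAut K" and inv: "inv\<^bsub>BijGroup K\<^esub> \<sigma> \<in> vAut K"
    and one: "\<one>\<^bsub>BijGroup K\<^esub> \<in> vAut K"
  shows "coeff_part \<sigma> \<in> carrier AutCoeff"
  unfolding in_AutCoeff_iff
proof (intro conjI allI)
  interpret Bij: group "BijGroup K" by (rule group_BijGroup)
  have carrier: "\<sigma> \<in> carrier (BijGroup K)"
    using vAut_Bij[OF \<sigma>] by (simp add: BijGroup_def)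
  have "coeff_part \<sigma> \<circ> coeff_part (inv\<^bsub>BijGroup K\<^esub> \<sigma>) = id"
    "coeff_part (inv\<^bsub>BijGroup K\<^esub> \<sigma>) \<circ> coeff_part \<sigma> = id"
    using coeff_part_mult[OF \<sigma> inv] coeff_part_mult[OF inv \<sigma>] carrier Phi_one[OF one]
    by (simp_all add: Phi_def)
  then show "bij (coeff_part \<sigma>)" by (metis o_bij)
  show "coeff_part \<sigma> (c + d) = coeff_part \<sigma> c + coeff_part \<sigma> d" for c d
  proof -
    have "mon (c + d) 0 = (\<lambda>g::'g. mon c 0 g + mon d 0 g)" by (auto simp: mon_def)
    then show ?thesis
      using vAut_add[OF \<sigma> mon_closed mon_closed, of c 0 d 0] by (simp add: coeff_part_def)
  qed
  show "coeff_part \<sigma> (c * d) = coeff_part \<sigma> c * coeff_part \<sigma> d" for c d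
  proof -
    have "\<sigma> (mon (c * d) 0) (0 + 0) = conv (\<sigma> (mon c 0)) (\<sigma> (mon d 0)) (0 + 0)"
      using vAut_mult[OF \<sigma> mon_closed mon_closed, of c 0 d 0] by (simp add: conv_mon)
    also have "\<dots> = \<sigma> (mon c 0) 0 * \<sigma> (mon d 0) 0"
      using vAut_vanish_mon[OF \<sigma>, of _ 0] by (intro conv_lead) (simp_all add: value_part_0[OF \<sigma>])
    finally show ?thesis by (simp add: coeff_part_def)
  qed
  show "coeff_part \<sigma> 1 = 1"
    by (simp add: coeff_part_def vAut_one[OF \<sigma>]) (simp add: mon_def)
qed

lemma in_IntAut_iff: "\<sigma> \<in> IntAut K \<longleftrightarrow> \<sigma> \<in> vAut K \<and> Phi K \<sigma> = (id, id)"
  by (simp add: IntAut_def kernel_def DirProd_def AutCoeff_simps oAut_simps)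


section \<open>The two retractions\<close>

lemma Phi_hom:
  assumes "subgroup A (BijGroup K)" and A: "A \<subseteq> vAut K"
  shows "Phi K \<in> hom (BijGroup K\<lparr>carrier := A\<rparr>) (AutCoeff \<times>\<times> oAut)"
    and "Phi K \<one>\<^bsub>BijGroup K\<^esub> = \<one>\<^bsub>AutCoeff \<times>\<times> oAut\<^esub>"
    and "kernel (BijGroup K\<lparr>carrier := A\<rparr>) (AutCoeff \<times>\<times> oAut) (Phi K) = A \<inter> IntAut K"
proof -
  interpret subgroup A "BijGroup K" by fact
  interpret Bij: group "BijGroup K" by (rule group_BijGroup)
  have mem: "coeff_part \<sigma> \<in> carrier AutCoeff \<and> value_part K \<sigma> \<in> carrier oAut"
    if "\<sigma> \<in> A" for \<sigma>
    using that A by (intro conjI coeff_part_AutCoeff value_part_oAut) auto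
  then show "Phi K \<in> hom (BijGroup K\<lparr>carrier := A\<rparr>) (AutCoeff \<times>\<times> oAut)"
    using A by (intro homI)
      (auto simp: Phi_def DirProd_def AutCoeff_simps oAut_simps coeff_part_mult value_part_mult subsetD)
  show "Phi K \<one>\<^bsub>BijGroup K\<^esub> = \<one>\<^bsub>AutCoeff \<times>\<times> oAut\<^esub>"
    using Phi_one[OF subsetD[OF A one_closed]] by (simp add: DirProd_def AutCoeff_simps oAut_simps)
  show "kernel (BijGroup K\<lparr>carrier := A\<rparr>) (AutCoeff \<times>\<times> oAut) (Phi K) = A \<inter> IntAut K"
    using A by (auto simp: in_IntAut_iff kernel_def DirProd_def AutCoeff_simps oAut_simps)
qed

text \<open>Both components of an internal automorphism \<open>\<sigma>\<close> are trivial, so by the leading term formula \<open>\<sigma>\<close>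
  multiplies the leading coefficient of \<open>\<tau>(t\<^sup>g)\<close> by \<open>\<sigma>(t\<^sup>g)\<^sub>g\<close>. This is multiplicativity in
  the automorphism; that in \<open>g\<close> is multiplicativity of leading coefficients. The kernel consists
  of 1-automorphisms by their very definition.\<close>

lemma lead_char_hom:
  assumes B: "B \<subseteq> IntAut K" and one: "\<one>\<^bsub>BijGroup K\<^esub> \<in> B"
  shows "lead_char \<in> hom (BijGroup K\<lparr>carrier := B\<rparr>) HomGroup"
    and "lead_char \<one>\<^bsub>BijGroup K\<^esub> = \<one>\<^bsub>HomGroup\<^esub>"
    and "kernel (BijGroup K\<lparr>carrier := B\<rparr>) HomGroup lead_char = B \<inter> oneAut K"
proof -
  have B': "\<sigma> \<in> vAut K" "value_part K \<sigma> = id" "coeff_part \<sigma> = id" if "\<sigma> \<in> B" for \<sigma>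
    using that B by (auto simp: in_IntAut_iff Phi_def)
  show "lead_char \<in> hom (BijGroup K\<lparr>carrier := B\<rparr>) HomGroup"
  proof (rule homI)
    fix \<sigma> assume "\<sigma> \<in> carrier (BijGroup K\<lparr>carrier := B\<rparr>)"
    then have \<sigma>: "\<sigma> \<in> B" by simp
    show "lead_char \<sigma> \<in> carrier HomGroup"
      using lead_nonzero[OF B'(1)[OF \<sigma>]] lead_add[OF B'(1)[OF \<sigma>]]
      by (simp add: HomGroup_def lead_char_def B'(2)[OF \<sigma>])
  next
    fix \<sigma> \<tau> assume "\<sigma> \<in> carrier (BijGroup K\<lparr>carrier := B\<rparr>)" "\<tau> \<in> carrier (BijGroup K\<lparr>carrier := B\<rparr>)"
    then have \<sigma>: "\<sigma> \<in> B" and \<tau>: "\<tau> \<in> B" by simp_all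
    have "\<sigma> (\<tau> (mon 1 g)) g = \<tau> (mon 1 g) g * \<sigma> (mon 1 g) g" for g
      using vAut_lead[OF B'(1)[OF \<sigma>] vAut_closed[OF B'(1)[OF \<tau>] mon_closed], of g 1 g]
        vAut_vanish_mon[OF B'(1)[OF \<tau>], of _ g]
      by (simp add: B'(2,3)[OF \<sigma>] B'(2)[OF \<tau>])
    then show "lead_char (\<sigma> \<otimes>\<^bsub>BijGroup K\<lparr>carrier := B\<rparr>\<^esub> \<tau>) = lead_char \<sigma> \<otimes>\<^bsub>HomGroup\<^esub> lead_char \<tau>"
      using vAut_Bij[OF B'(1)[OF \<sigma>]] vAut_Bij[OF B'(1)[OF \<tau>]]
      by (simp add: HomGroup_def lead_char_def BijGroup_mult_apply mon_closed mult.commute)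
  qed
  show "lead_char \<one>\<^bsub>BijGroup K\<^esub> = \<one>\<^bsub>HomGroup\<^esub>"
    by (simp add: lead_char_def HomGroup_def BijGroup_def mon_closed) (simp add: mon_def)
  show "kernel (BijGroup K\<lparr>carrier := B\<rparr>) HomGroup lead_char = B \<inter> oneAut K"
    using B by (auto simp: kernel_def oneAut_def HomGroup_def lead_char_def fun_eq_iff)
qed


section \<open>Strong additivity of the complements\<close>

text \<open>A map that computes each coefficient \<open>h\<close> of the result from the single coefficient \<open>\<theta>(h)\<close> of the
  argument sends the terms of a series \<open>a\<close> to series with disjoint supports inside the support of
  \<open>\<sigma>(a)\<close>. So summing the images never adds two nonzero coefficients.\<close>

lemma coefficientwise_summable:
  assumes closed: "\<And>a. a \<in> K \<Longrightarrow> \<sigma> a \<in> K"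
    and \<sigma>: "\<And>a h. a \<in> K \<Longrightarrow> \<sigma> a h = f h (a (\<theta> h))" and f0: "\<And>h. f h 0 = 0"
  shows "K_summable_map K \<sigma>"
  unfolding K_summable_map_def
proof
  fix a assume a: "a \<in> K"
  let ?F = "\<lambda>g. \<sigma> (mon (a g) g)"
  have F: "?F g h = (if g = \<theta> h then \<sigma> a h else 0)" for g h
    unfolding \<sigma>[OF mon_closed] \<sigma>[OF a] by (auto simp: mon_def f0)
  have "(\<Union>g\<in>supp a. supp (?F g)) \<subseteq> supp (\<sigma> a)"
    by (auto simp: supp_def F split: if_splits)
  then have wo: "well_ordered (\<Union>g\<in>supp a. supp (?F g))"
    using well_ordered_supp[OF closed[OF a]] subset_trans unfolding well_ordered_def by meson
  have fin: "finite {g \<in> supp a. h \<in> supp (?F g)}" for h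
    by (rule finite_subset[of _ "{\<theta> h}"]) (auto simp: supp_def F split: if_splits)
  have sum: "family_sum (supp a) ?F = \<sigma> a"
  proof
    fix h
    have "family_sum (supp a) ?F h = (\<Sum>g\<in>{\<theta> h}. ?F g h)"
      unfolding family_sum_def
      by (rule sum.mono_neutral_left) (auto simp: supp_def F \<sigma>[OF a] f0 split: if_splits)
    then show "family_sum (supp a) ?F h = \<sigma> a h" by (simp add: F)
  qed
  show "K_summable_family K (supp a) ?F \<and> family_sum (supp a) ?F = \<sigma> a"
    using wo fin sum closed[OF a] closed[OF mon_closed]
    by (auto simp: K_summable_family_def summable_family_def)
qed

text \<open>For bijective data the inverse map is coefficientwise as well.\<close>

lemma coefficientwise_strong:
  assumes A: "\<sigma> \<in> A" and Bij: "\<sigma> \<in> Bij K"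
    and \<sigma>: "\<And>a h. a \<in> K \<Longrightarrow> \<sigma> a h = f h (a (\<theta> h))" and f0: "\<And>h. f h 0 = 0"
    and inj: "\<And>h. inj (f h)" and \<theta>: "bij \<theta>"
  shows "\<sigma> \<in> strong K A"
proof -
  let ?\<iota> = "inv\<^bsub>BijGroup K\<^esub> \<sigma>"
  have inverse: "?\<iota> a h = inv_into UNIV (f (inv_into UNIV \<theta> h)) (a (inv_into UNIV \<theta> h))"
    if a: "a \<in> K" for a h
  proof -
    let ?h = "inv_into UNIV \<theta> h"
    have "a ?h = f ?h (?\<iota> a h)"
      using \<sigma>[OF Bij_inverse(1)[OF Bij a], of ?h] \<theta>
      by (simp add: Bij_inverse(2)[OF Bij a] surj_f_inv_f bij_is_surj)
    then show ?thesis using inj by simp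
  qed
  have "inv_into UNIV (f h) 0 = 0" for h
    using inv_f_f[OF inj, of h 0] by (simp add: f0)
  then have "K_summable_map K ?\<iota>"
    by (intro coefficientwise_summable[OF _ inverse]) (simp_all add: Bij_inverse(1)[OF Bij])
  moreover have "K_summable_map K \<sigma>"
    using Bij_inverse(4)[OF Bij] \<sigma> f0 by (rule coefficientwise_summable)
  ultimately show ?thesis using A by (simp add: strong_def)
qed


section \<open>Automorphisms respecting the coefficient field\<close>

lemma stab_coeff_subgroup:
  assumes "subgroup (strong K (vAut K)) (BijGroup K)"
  shows "subgroup (strong K (stab_coeff (vAut K))) (BijGroup K)"
proof -
  interpret S: subgroup "strong K (vAut K)" "BijGroup K" by fact
  interpret Bij: group "BijGroup K" by (rule group_BijGroup)
  let ?k = "range (\<lambda>c. mon c 0) :: ('g \<Rightarrow> 'k) set"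
  have kK: "?k \<subseteq> K" using mon_closed by auto
  have mem: "\<sigma> \<in> strong K (stab_coeff (vAut K)) \<longleftrightarrow> \<sigma> \<in> strong K (vAut K) \<and> \<sigma> ` ?k = ?k" for \<sigma>
    by (auto simp: strong_def stab_coeff_def)
  have Bij: "\<sigma> \<in> Bij K" if "\<sigma> \<in> strong K (vAut K)" for \<sigma>
    using that vAut_Bij by (auto simp: strong_def)
  show ?thesis
  proof (rule Bij.subgroupI)
    show "strong K (stab_coeff (vAut K)) \<subseteq> carrier (BijGroup K)"
      using S.subset by (auto simp: mem)
    have "\<one>\<^bsub>BijGroup K\<^esub> ` ?k = ?k"
      using kK by (force simp: BijGroup_def image_iff)
    then show "strong K (stab_coeff (vAut K)) \<noteq> {}"
      using S.one_closed mem by blast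
  next
    fix \<sigma> assume "\<sigma> \<in> strong K (stab_coeff (vAut K))"
    then have \<sigma>: "\<sigma> \<in> strong K (vAut K)" and stab: "\<sigma> ` ?k = ?k" by (auto simp: mem)
    have "(inv\<^bsub>BijGroup K\<^esub> \<sigma>) ` ?k = (inv\<^bsub>BijGroup K\<^esub> \<sigma>) ` \<sigma> ` ?k" by (simp only: stab)
    also have "\<dots> = ?k"
      unfolding image_image[of _ \<sigma>] using kK Bij_inverse(3)[OF Bij[OF \<sigma>]]
      by (intro image_cong[where g = id, simplified]) auto
    finally show "inv\<^bsub>BijGroup K\<^esub> \<sigma> \<in> strong K (stab_coeff (vAut K))"
      using \<sigma> by (simp add: mem)
  next
    fix \<sigma> \<tau> assume "\<sigma> \<in> strong K (stab_coeff (vAut K))" "\<tau> \<in> strong K (stab_coeff (vAut K))"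
    then have \<sigma>: "\<sigma> \<in> strong K (vAut K)" "\<sigma> ` ?k = ?k" and \<tau>: "\<tau> \<in> strong K (vAut K)" "\<tau> ` ?k = ?k"
      by (auto simp: mem)
    have "(\<sigma> \<otimes>\<^bsub>BijGroup K\<^esub> \<tau>) ` ?k = \<sigma> ` \<tau> ` ?k"
      unfolding image_image[of \<sigma> \<tau>] using kK BijGroup_mult_apply[OF Bij[OF \<sigma>(1)] Bij[OF \<tau>(1)]]
      by (intro image_cong) auto
    then show "\<sigma> \<otimes>\<^bsub>BijGroup K\<^esub> \<tau> \<in> strong K (stab_coeff (vAut K))"
      using \<sigma> \<tau> by (simp add: mem)
  qed
qed

lemma fix_coeff_subgroup:
  assumes "subgroup (strong K (vAut K)) (BijGroup K)"
  shows "subgroup (strong K (fix_coeff (vAut K))) (BijGroup K)"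
proof -
  interpret S: subgroup "strong K (vAut K)" "BijGroup K" by fact
  interpret Bij: group "BijGroup K" by (rule group_BijGroup)
  have mem: "\<sigma> \<in> strong K (fix_coeff (vAut K)) \<longleftrightarrow>
      \<sigma> \<in> strong K (vAut K) \<and> (\<forall>c. \<sigma> (mon c 0) = mon c 0)" for \<sigma>
    by (auto simp: strong_def fix_coeff_def)
  have Bij: "\<sigma> \<in> Bij K" if "\<sigma> \<in> strong K (vAut K)" for \<sigma>
    using that vAut_Bij by (auto simp: strong_def)
  show ?thesis
  proof (rule Bij.subgroupI)
    show "strong K (fix_coeff (vAut K)) \<subseteq> carrier (BijGroup K)"
      using S.subset by (auto simp: mem)
    have "\<one>\<^bsub>BijGroup K\<^esub> \<in> strong K (fix_coeff (vAut K))"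
      using S.one_closed by (simp add: mem) (simp add: BijGroup_def mon_closed)
    then show "strong K (fix_coeff (vAut K)) \<noteq> {}" by blast
  next
    fix \<sigma> assume \<sigma>: "\<sigma> \<in> strong K (fix_coeff (vAut K))"
    have "(inv\<^bsub>BijGroup K\<^esub> \<sigma>) (mon c 0) = mon c 0" for c
      using \<sigma> Bij_inverse(3)[OF Bij mon_closed, of \<sigma> c 0] by (simp add: mem)
    then show "inv\<^bsub>BijGroup K\<^esub> \<sigma> \<in> strong K (fix_coeff (vAut K))"
      using \<sigma> by (simp add: mem)
  next
    fix \<sigma> \<tau> assume "\<sigma> \<in> strong K (fix_coeff (vAut K))" "\<tau> \<in> strong K (fix_coeff (vAut K))"
    then show "\<sigma> \<otimes>\<^bsub>BijGroup K\<^esub> \<tau> \<in> strong K (fix_coeff (vAut K))"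
      using Bij by (simp add: mem BijGroup_mult_apply mon_closed)
  qed
qed

text \<open>This is why the same group of 1-automorphisms occurs for both subscripts: an internal
  automorphism keeps the constant term of a constant, so if it maps constants to constants then it
  fixes them.\<close>

lemma stab_coeff_IntAut: "stab_coeff (IntAut K) = fix_coeff (IntAut K)"
proof (intro equalityI subsetI)
  fix \<sigma> assume "\<sigma> \<in> stab_coeff (IntAut K)"
  then have \<sigma>: "\<sigma> \<in> IntAut K" and stab: "\<sigma> ` range (\<lambda>c. mon c 0) = range (\<lambda>c. mon c 0)"
    by (auto simp: stab_coeff_def)
  have "\<sigma> (mon c 0) = mon c 0" for c
  proof -
    obtain d where d: "\<sigma> (mon c 0) = mon d 0" using stab by blast
    moreover have "\<sigma> (mon c 0) 0 = c"
      using \<sigma> by (simp add: in_IntAut_iff Phi_def coeff_part_def fun_eq_iff)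
    moreover have "mon d (0 :: 'g) 0 = d" by (simp add: mon_def)
    ultimately show ?thesis by simp
  qed
  then show "\<sigma> \<in> fix_coeff (IntAut K)" using \<sigma> by (simp add: fix_coeff_def)
qed (auto simp: fix_coeff_def stab_coeff_def image_image)

text \<open>Together with \<open>lead_char_hom\<close>, this makes \<open>x \<mapsto> \<rho>\<^sub>x\<close> a section of the leading coefficient
  map. It takes values in the automorphisms fixing \<open>k\<close> since a character is \<open>1\<close> at \<open>0\<close>, so the same
  section serves all three decompositions.\<close>

lemma g_exp_strong:
  assumes lift: "canonical_second_lifting K" and x: "x \<in> carrier HomGroup"
  shows "g_exp K x \<in> strong K (fix_coeff (IntAut K))" and "lead_char (g_exp K x) = x"
proof -
  have I: "g_exp K x \<in> IntAut K"
    using lift x by (auto simp: canonical_second_lifting_def hom_def)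
  have x_nonzero: "x g \<noteq> 0" for g using x by (simp add: HomGroup_def)
  have "x (0 + 0) = x 0 * x 0" using x unfolding HomGroup_def by (simp del: add_0_left add_0_right)
  then have "x 0 = 1" using x_nonzero[of 0] by simp
  then have "g_exp K x (mon c 0) = mon c 0" for c
    by (simp add: g_exp_def mon_closed) (auto simp: mon_def fun_eq_iff)
  then show "g_exp K x \<in> strong K (fix_coeff (IntAut K))"
    using I vAut_Bij x_nonzero
    by (intro coefficientwise_strong[where f = "\<lambda>h c. c * x h" and \<theta> = id])
      (auto simp: fix_coeff_def g_exp_def in_IntAut_iff inj_on_def)
  show "lead_char (g_exp K x) = x"
    by (simp add: lead_char_def g_exp_def mon_closed) (simp add: mon_def)
qed

lemma canonical_lift_strong:
  assumes p: "p \<in> carrier (AutCoeff \<times>\<times> oAut)" and aut: "canonical_lift K p \<in> vAut K"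
  shows "canonical_lift K p \<in> strong K (stab_coeff (vAut K))"
proof -
  obtain \<rho> \<tau> where p_eq: "p = (\<rho>, \<tau>)" and \<rho>: "\<rho> \<in> carrier AutCoeff" and \<tau>: "\<tau> \<in> carrier oAut"
    using p by (auto simp: DirProd_def)
  have \<tau>_inv: "inv_into UNIV \<tau> h = 0 \<longleftrightarrow> h = 0" for h
  proof -
    have "\<tau> (0 + 0) = \<tau> 0 + \<tau> 0" using \<tau> unfolding in_oAut_iff by (simp del: add_0_left add_0_right)
    then have "\<tau> 0 = 0" by simp
    then show ?thesis using \<tau> by (metis in_oAut_iff bij_is_inj bij_is_surj inv_f_f surj_f_inv_f)
  qed
  have "\<rho> (0 + 0) = \<rho> 0 + \<rho> 0" using \<rho> unfolding in_AutCoeff_iff by (simp del: add_0_left add_0_right)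
  then have \<rho>0: "\<rho> 0 = 0" by (simp only: add_0_left add_cancel_right_left)
  have "canonical_lift K p (mon c 0) = mon (\<rho> c) 0" for c
    by (auto simp: p_eq canonical_lift_def mon_closed fun_eq_iff) (auto simp: mon_def \<tau>_inv \<rho>0)
  then have "canonical_lift K p ` range (\<lambda>c. mon c 0) = (\<lambda>c. mon c 0) ` range \<rho>"
    by (simp add: image_image)
  then have "canonical_lift K p \<in> stab_coeff (vAut K)"
    using aut \<rho> by (simp add: stab_coeff_def in_AutCoeff_iff bij_is_surj)
  then show ?thesis
    using \<rho> \<tau> vAut_Bij[OF aut]
    by (intro coefficientwise_strong[where f = "\<lambda>h. \<rho>" and \<theta> = "inv_into UNIV \<tau>"])
      (auto simp: p_eq canonical_lift_def \<rho>0 in_AutCoeff_iff in_oAut_iff bij_is_inj bij_imp_bij_inv)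
qed

end


section \<open>The decompositions\<close>

theorem theorem4p1p3:
  fixes K :: "('g::linordered_ab_group_add \<Rightarrow> 'k::field) set"
    and \<Psi> :: "('k \<Rightarrow> 'k) \<times> ('g \<Rightarrow> 'g) \<Rightarrow> ('g \<Rightarrow> 'k) \<Rightarrow> 'g \<Rightarrow> 'k"
  assumes hahn: "hahn_field K"
    and first_lift: "first_lifting K \<Psi>"
    and second_lift: "canonical_second_lifting K"
    and strong_group: "subgroup (strong K (vAut K)) (BijGroup K)"
    and strong_lift: "\<not> canonical_first_lifting K \<Longrightarrow> ExtAut \<Psi> \<subseteq> strong K (stab_coeff (vAut K))"
  shows
    "inner_semidirect3 (BijGroup K) (strong K (vAut K))
        (strong K (oneAut K)) (GExp K) (ExtAut \<Psi>) \<and>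
     outer_semidirect3 (BijGroup K) (strong K (vAut K))
        (strong K (oneAut K)) HomGroup (g_exp K) (AutCoeff \<times>\<times> oAut) \<Psi> \<and>
     inner_semidirect3 (BijGroup K) (strong K (stab_coeff (vAut K)))
        (strong K (fix_coeff (oneAut K))) (GExp K) (ExtAut \<Psi>) \<and>
     outer_semidirect3 (BijGroup K) (strong K (stab_coeff (vAut K)))
        (strong K (fix_coeff (oneAut K))) HomGroup (g_exp K) (AutCoeff \<times>\<times> oAut) \<Psi> \<and>
     inner_semidirect3 (BijGroup K) (strong K (fix_coeff (vAut K)))
        (strong K (fix_coeff (oneAut K))) (GExp K) (fix_coeff (ExtAut \<Psi>)) \<and>
     outer_semidirect3 (BijGroup K) (strong K (fix_coeff (vAut K)))
        (strong K (fix_coeff (oneAut K))) HomGroup (g_exp K) oAut (\<lambda>\<tau>. \<Psi> (id, \<tau>))"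
proof -
  interpret hahn_subfield K by unfold_locales (fact hahn)
  interpret Bij: group "BijGroup K" by (rule group_BijGroup)
  let ?Q = "AutCoeff \<times>\<times> oAut :: (('k \<Rightarrow> 'k) \<times> ('g \<Rightarrow> 'g)) monoid"
  let ?S = "strong K (vAut K)" and ?S' = "strong K (stab_coeff (vAut K))"
    and ?S'' = "strong K (fix_coeff (vAut K))"
  let ?I = "strong K (IntAut K)" and ?I' = "strong K (fix_coeff (IntAut K))"
  have \<Psi>_vAut: "\<Psi> p \<in> vAut K" and Phi_\<Psi>: "Phi K (\<Psi> p) = p" if "p \<in> carrier ?Q" for p
    using first_lift that by (auto simp: first_lifting_def hom_def)
  have \<Psi>_mult: "\<Psi> (p \<otimes>\<^bsub>?Q\<^esub> q) = \<Psi> p \<otimes>\<^bsub>BijGroup K\<^esub> \<Psi> q" if "p \<in> carrier ?Q" "q \<in> carrier ?Q" for p q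
    using first_lift that unfolding first_lifting_def hom_def by auto
  \<comment> \<open>The canonical lifts are strongly additive because they are coefficientwise; a section that is
    not canonical is strongly additive by assumption.\<close>
  have \<Psi>_S': "\<Psi> p \<in> ?S'" if p: "p \<in> carrier ?Q" for p
  proof (cases "canonical_first_lifting K")
    case True
    then have "\<Psi> p = canonical_lift K p" using first_lift p unfolding first_lifting_def by blast
    then show ?thesis using canonical_lift_strong[OF p] \<Psi>_vAut[OF p] by simp
  next
    case False
    then show ?thesis using strong_lift p by (auto simp: ExtAut_def)
  qed
  have S'S: "?S' \<subseteq> ?S" by (auto simp: strong_def stab_coeff_def)
  have group': "subgroup ?S' (BijGroup K)" and group'': "subgroup ?S'' (BijGroup K)"
    using strong_group by (rule stab_coeff_subgroup, rule fix_coeff_subgroup)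
  have sub: "?S \<subseteq> vAut K" "?S' \<subseteq> vAut K" "?S'' \<subseteq> vAut K"
    by (auto simp: strong_def stab_coeff_def fix_coeff_def)
  have IntAut_vAut: "IntAut K \<subseteq> vAut K" by (auto simp: in_IntAut_iff)
  have kernel: "?S \<inter> IntAut K = ?I"
    using IntAut_vAut by (auto simp: strong_def)
  have kernel': "?S' \<inter> IntAut K = ?I'"
    unfolding stab_coeff_IntAut[symmetric] using IntAut_vAut by (auto simp: strong_def stab_coeff_def)
  have kernel'': "?S'' \<inter> IntAut K = ?I'"
    using IntAut_vAut by (auto simp: strong_def fix_coeff_def)
  have N: "?I \<inter> oneAut K = strong K (oneAut K)" "?I' \<inter> oneAut K = strong K (fix_coeff (oneAut K))"
    by (auto simp: strong_def fix_coeff_def oneAut_def)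
  have I: "?I \<subseteq> IntAut K" "?I' \<subseteq> IntAut K" "?I' \<subseteq> ?I"
    by (auto simp: strong_def fix_coeff_def)
  have one_I': "\<one>\<^bsub>BijGroup K\<^esub> \<in> ?I'"
    unfolding kernel''[symmetric]
    using subgroup.one_closed[OF group''] Phi_one sub(3) by (auto simp: in_IntAut_iff)
  then have one_I: "\<one>\<^bsub>BijGroup K\<^esub> \<in> ?I" using I by blast
  have e_hom: "g_exp K \<in> hom HomGroup (BijGroup K\<lparr>carrier := ?I'\<rparr>)"
    "g_exp K \<in> hom HomGroup (BijGroup K\<lparr>carrier := ?I\<rparr>)"
    using second_lift g_exp_strong(1)[OF second_lift] I(3)
    unfolding canonical_second_lifting_def hom_def by auto
  have \<Psi>_hom: "\<Psi> \<in> hom ?Q (BijGroup K\<lparr>carrier := ?S'\<rparr>)" "\<Psi> \<in> hom ?Q (BijGroup K\<lparr>carrier := ?S\<rparr>)"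
    using \<Psi>_S' subsetD[OF S'S \<Psi>_S'] \<Psi>_mult by (auto simp: hom_def)
  have "inner_semidirect3 (BijGroup K) ?S (strong K (oneAut K)) (GExp K) (ExtAut \<Psi>)
      \<and> outer_semidirect3 (BijGroup K) ?S (strong K (oneAut K)) HomGroup (g_exp K) ?Q \<Psi>"
    unfolding GExp_def ExtAut_def
    using semidirect3_of_retractions[OF Bij.is_group strong_group Phi_hom(1,2)[OF strong_group sub(1)]
        \<Psi>_hom(2) Phi_\<Psi> Phi_hom(3)[OF strong_group sub(1), unfolded kernel] lead_char_hom(1,2)[OF I(1) one_I]
        e_hom(2) g_exp_strong(2)[OF second_lift] lead_char_hom(3)[OF I(1) one_I, unfolded N(1)]]
    by blast
  moreover have "inner_semidirect3 (BijGroup K) ?S' (strong K (fix_coeff (oneAut K))) (GExp K) (ExtAut \<Psi>)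
      \<and> outer_semidirect3 (BijGroup K) ?S' (strong K (fix_coeff (oneAut K))) HomGroup (g_exp K) ?Q \<Psi>"
    unfolding GExp_def ExtAut_def
    using semidirect3_of_retractions[OF Bij.is_group group' Phi_hom(1,2)[OF group' sub(2)]
        \<Psi>_hom(1) Phi_\<Psi> Phi_hom(3)[OF group' sub(2), unfolded kernel'] lead_char_hom(1,2)[OF I(2) one_I']
        e_hom(1) g_exp_strong(2)[OF second_lift] lead_char_hom(3)[OF I(2) one_I', unfolded N(2)]]
    by blast
  moreover have "inner_semidirect3 (BijGroup K) ?S'' (strong K (fix_coeff (oneAut K)))
        (GExp K) (fix_coeff (ExtAut \<Psi>))
      \<and> outer_semidirect3 (BijGroup K) ?S'' (strong K (fix_coeff (oneAut K)))
        HomGroup (g_exp K) oAut (\<lambda>\<tau>. \<Psi> (id, \<tau>))"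
  proof -
    have id_mem: "(id, \<tau>) \<in> carrier ?Q" if "\<tau> \<in> carrier oAut" for \<tau>
      using that by (simp add: DirProd_def in_AutCoeff_iff)
    have coeff_id: "coeff_part \<sigma> = id" if "\<And>c. \<sigma> (mon c 0) = mon c 0" for \<sigma> :: "('g \<Rightarrow> 'k) \<Rightarrow> 'g \<Rightarrow> 'k"
      using that by (simp add: coeff_part_def fun_eq_iff) (simp add: mon_def)
    \<comment> \<open>Being in the stabiliser of \<open>k\<close>, \<open>\<Psi>(\<rho>, \<tau>)\<close> maps each constant \<open>c\<close> to the constant \<open>\<rho>(c)\<close>.\<close>
    have fix_iff: "(\<forall>c. \<Psi> (\<rho>, \<tau>) (mon c 0) = mon c 0) \<longleftrightarrow> \<rho> = id"
      if p: "(\<rho>, \<tau>) \<in> carrier ?Q" for \<rho> \<tau>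
    proof
      assume "\<forall>c. \<Psi> (\<rho>, \<tau>) (mon c 0) = mon c 0"
      then show "\<rho> = id" using coeff_id Phi_\<Psi>[OF p] by (auto simp: Phi_def)
    next
      assume "\<rho> = id"
      then have "coeff_part (\<Psi> (\<rho>, \<tau>)) = id" using Phi_\<Psi>[OF p] by (simp add: Phi_def)
      moreover have "\<exists>d. \<Psi> (\<rho>, \<tau>) (mon c 0) = mon d 0" for c
        using \<Psi>_S'[OF p] by (auto simp: strong_def stab_coeff_def)
      ultimately show "\<forall>c. \<Psi> (\<rho>, \<tau>) (mon c 0) = mon c 0"
        by (metis coeff_part_def id_apply mon_def)
    qed
    have fix_Ext: "fix_coeff (ExtAut \<Psi>) = (\<lambda>\<tau>. \<Psi> (id, \<tau>)) ` carrier oAut"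
      using fix_iff id_mem by (auto simp: fix_coeff_def ExtAut_def DirProd_def)
    have \<Psi>_hom'': "(\<lambda>\<tau>. \<Psi> (id, \<tau>)) \<in> hom oAut (BijGroup K\<lparr>carrier := ?S''\<rparr>)"
    proof (rule homI)
      fix \<tau> \<tau>' :: "'g \<Rightarrow> 'g" assume \<tau>: "\<tau> \<in> carrier oAut" "\<tau>' \<in> carrier oAut"
      have eq: "(id, \<tau> \<otimes>\<^bsub>oAut\<^esub> \<tau>') = (id, \<tau>) \<otimes>\<^bsub>?Q\<^esub> (id, \<tau>')"
        by (simp add: DirProd_def AutCoeff_simps in_AutCoeff_iff)
      show "\<Psi> (id, \<tau> \<otimes>\<^bsub>oAut\<^esub> \<tau>') = \<Psi> (id, \<tau>) \<otimes>\<^bsub>BijGroup K\<lparr>carrier := ?S''\<rparr>\<^esub> \<Psi> (id, \<tau>')"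
        unfolding eq using \<Psi>_mult[OF id_mem[OF \<tau>(1)] id_mem[OF \<tau>(2)]] by simp
    next
      fix \<tau> :: "'g \<Rightarrow> 'g" assume "\<tau> \<in> carrier oAut"
      then show "\<Psi> (id, \<tau>) \<in> carrier (BijGroup K\<lparr>carrier := ?S''\<rparr>)"
        using \<Psi>_S'[OF id_mem] fix_iff[OF id_mem]
        by (simp add: strong_def fix_coeff_def stab_coeff_def)
    qed
    \<comment> \<open>On automorphisms fixing \<open>k\<close> the first component of \<open>\<Phi>\<close> is trivial, so the second one alone
      is the retraction, with the same kernel.\<close>
    have value_hom: "value_part K \<in> hom (BijGroup K\<lparr>carrier := ?S''\<rparr>) oAut"
      "value_part K \<one>\<^bsub>BijGroup K\<^esub> = \<one>\<^bsub>oAut\<^esub>"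
      using Phi_hom(1,2)[OF group'' sub(3)]
      by (auto simp: hom_def Phi_def DirProd_def)
    have value_\<Psi>: "value_part K (\<Psi> (id, \<tau>)) = \<tau>" if "\<tau> \<in> carrier oAut" for \<tau>
      using Phi_\<Psi>[OF id_mem[OF that]] by (simp add: Phi_def)
    have value_kernel: "kernel (BijGroup K\<lparr>carrier := ?S''\<rparr>) oAut (value_part K) = ?S'' \<inter> IntAut K"
      using sub(3) coeff_id
      by (auto simp: kernel_def in_IntAut_iff Phi_def oAut_simps strong_def fix_coeff_def)
    show ?thesis
      unfolding GExp_def fix_Ext
      using semidirect3_of_retractions[OF Bij.is_group group'' value_hom \<Psi>_hom'' value_\<Psi>
          value_kernel[unfolded kernel''] lead_char_hom(1,2)[OF I(2) one_I'] e_hom(1)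
          g_exp_strong(2)[OF second_lift] lead_char_hom(3)[OF I(2) one_I', unfolded N(2)]]
      by blast
  qed
  ultimately show ?thesis by blast
qed

end
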